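(* Let $X$ be a binary curve of genus $g$, and let $d\ge 2g-1$. (i) For every balanced line bundle $L$ of degree $d$ on $X$ we have $h^0(X,L)=d-g+1$. (ii) If $g\ge2$, for every $[\widehat L]\in\overline{P^d_X}$ we have $h^0(\widehat L)=d-g+1$.
   Context: Work over an algebraically closed field. A binary curve of genus $g$ is a reduced nodal curve $X=C_1\cup C_2$ with $C_1\cong C_2\cong\mathbb P^1$ and $\#(C_1\cap C_2)=g+1$ ($g\ge-1$ is the arithmetic genus). A multidegree $\underline d=(d_1,d_2)$ with $d_1+d_2=d$ is balanced on a binary curve of genus $g$ if $\frac{d-g-1}{2}\le d_i\le\frac{d+g+1}{2}$ for $i=1,2$, strictly balanced if the inequalities are strict; a line bundle is (strictly) balanced if its multidegree is. For $S\subset X_{\mathrm{sing}}$ let $Y_S$ be the normalization of $X$ at the nodes in $S$ (a binary curve of genus $g-\#S$), and let $\widehat X_S=Y_S\cup E_1\cup\dots\cup E_{\#S}$ be the blow-up of $X$ at $S$: each $E_i\cong\mathbb P^1$ is attached to $Y_S$ at the two points lying over a node of $S$. A line bundle $\widehat L$ of degree $d$ on $\widehat X_S$ is (strictly) balanced if it has degree $1$ on each $E_i$ and its restriction to $Y_S$ is (strictly) balanced on $Y_S$; two such line bundles are equivalent if their restrictions to $Y_S$ are isomorphic. The compactified Picard variety $\overline{P^d_X}$ (for $g\ge 2$) has as points the equivalence classes $[\widehat L]$ of strictly balanced line bundles of degree $d$ on the curves $\widehat X_S$, $S\subset X_{\mathrm{sing}}$ (equivalently pairs $[M,S]$, $M=\widehat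 L|_{Y_S}$), together with, when $m:=\frac{d-g-1}{2}\in\mathbb Z$, one additional point $\ell_0$, given by $S=X_{\mathrm{sing}}$ and $M=(\mathcal O_{\mathbb P^1}(m),\mathcal O_{\mathbb P^1}(m))$ on $C_1\sqcup C_2$. For a point $[\widehat L]=[M,S]$, $h^0(\widehat L)=h^0(\widehat X_S,\widehat L)=h^0(Y_S,M)$, which does not depend on the representative. *)

theory Defs
  imports
    "HOL-Analysis.Function_Topology"
    "HOL-Computational_Algebra.Polynomial"
    "HOL-Library.Function_Algebras"
begin

section \<open>Spaces with functions and the projective line\<close>

text \<open>
  Reduced varieties over an algebraically closed field are treated in the classical language: a
  Zariski topology on the set of closed points, together with the sheaf of regular functions, which
  is a subsheaf of the sheaf of all functions with values in the field.
  Only the values on \<open>U\<close> matter in \<open>regular X U f\<close>.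
\<close>

record ('x, 'k) fun_space =
  zariski :: "'x topology"
  regular :: "'x set \<Rightarrow> ('x \<Rightarrow> 'k) \<Rightarrow> bool"

abbreviation points :: "('x, 'k, 'z) fun_space_scheme \<Rightarrow> 'x set" where
  "points X \<equiv> topspace (zariski X)"

quotient_type (overloaded) 'k proj1 = "'k::field \<times> 'k" /
  partial: "\<lambda>u v. u \<noteq> (0, 0) \<and> v \<noteq> (0, 0) \<and> fst u * snd v = snd u * fst v"
proof (rule part_equivpI)
  show "\<exists>x :: 'k \<times> 'k. x \<noteq> (0, 0) \<and> x \<noteq> (0, 0) \<and> fst x * snd x = snd x * fst x"
    by (intro exI[of _ "(1, 1)"]) simp
  show "symp (\<lambda>u v :: 'k \<times> 'k. u \<noteq> (0, 0) \<and> v \<noteq> (0, 0) \<and> fst u * snd v = snd u * fst v)"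
    by (auto simp: symp_def mult.commute)
  show "transp (\<lambda>u v :: 'k \<times> 'k. u \<noteq> (0, 0) \<and> v \<noteq> (0, 0) \<and> fst u * snd v = snd u * fst v)"
  proof (rule transpI, elim conjE, intro conjI)
    fix u v w :: "'k \<times> 'k"
    assume v: "v \<noteq> (0, 0)"
      and uv: "fst u * snd v = snd u * fst v" and vw: "fst v * snd w = snd v * fst w"
    have "fst v * (fst u * snd w) = fst u * (fst v * snd w)"
      by (simp add: ac_simps)
    also have "\<dots> = (fst u * snd v) * fst w"
      by (simp add: vw ac_simps)
    also have "\<dots> = fst v * (snd u * fst w)"
      by (simp add: uv ac_simps)
    finally have 1: "fst v * (fst u * snd w) = fst v * (snd u * fst w)" .
    have "snd v * (fst u * snd w) = (fst u * snd v) * snd w"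
      by (simp add: ac_simps)
    also have "\<dots> = snd u * (fst v * snd w)"
      by (simp add: uv ac_simps)
    also have "\<dots> = snd v * (snd u * fst w)"
      by (simp add: vw ac_simps)
    finally have 2: "snd v * (fst u * snd w) = snd v * (snd u * fst w)" .
    show "fst u * snd w = snd u * fst w"
      using 1 2 v by (cases v) auto
  qed
qed

lift_definition pt_zero :: "'k::field proj1" is "(0, 1)" by simp

lift_definition pt_infty :: "'k::field proj1" is "(1, 0)" by simp

text \<open>
  The value of the binary form \<open>\<Sum>i\<le>n. c\<^sub>i x\<^sup>i y\<^sup>n\<^sup>-\<^sup>i\<close> at a chosen vector of homogeneous coordinates.
  It is used only through its vanishing and through quotients of two forms of equal degree,
  which do not depend on the choice.
\<close>

definition form_eval :: "nat \<Rightarrow> (nat \<Rightarrow> 'k::field) \<Rightarrow> 'k proj1 \<Rightarrow> 'k" where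
  "form_eval n c p = (\<Sum>i\<le>n. c i * fst (rep_proj1 p) ^ i * snd (rep_proj1 p) ^ (n - i))"

definition P1 :: "('k::field proj1, 'k) fun_space" where
  "P1 = (let T = topology_generated_by {{p. form_eval n c p \<noteq> 0} |n c. True} in
    \<lparr>zariski = T,
     regular = (\<lambda>U f. \<forall>p\<in>U. \<exists>V. openin T V \<and> p \<in> V \<and> V \<subseteq> U \<and>
       (\<exists>n a b. \<forall>q\<in>V. form_eval n b q \<noteq> 0 \<and> f q = form_eval n a q / form_eval n b q))\<rparr>)"

section \<open>Line bundles\<close>

text \<open>
  A line bundle is given by its transition functions with respect to a trivializing open cover;
  a section is a family of regular functions \<open>s\<^sub>i\<close> with \<open>s\<^sub>i = g\<^sub>i\<^sub>j s\<^sub>j\<close> on overlaps.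
\<close>

record ('i, 'x, 'k) lbundle =
  cover :: "'i \<Rightarrow> 'x set"
  transition :: "'i \<Rightarrow> 'i \<Rightarrow> 'x \<Rightarrow> 'k"

definition line_bundle :: "('x, 'k::field) fun_space \<Rightarrow> ('i, 'x, 'k) lbundle \<Rightarrow> bool" where
  "line_bundle X L \<longleftrightarrow>
     (\<forall>i. openin (zariski X) (cover L i)) \<and>
     (\<Union>i. cover L i) = points X \<and>
     (\<forall>i j. regular X (cover L i \<inter> cover L j) (transition L i j)) \<and>
     (\<forall>i j. \<forall>x \<in> cover L i \<inter> cover L j. transition L i j x \<noteq> 0) \<and>
     (\<forall>i j l. \<forall>x \<in> cover L i \<inter> cover L j \<inter> cover L l.
        transition L i j x * transition L j l x = transition L i l x)"

text \<open>
  An isomorphism \<open>L \<rightarrow> M\<close> is, in local trivializations, multiplication by invertible regular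
  functions \<open>a\<^sub>i\<^sub>j\<close> (from the \<open>i\<close>-th chart of \<open>L\<close> to the \<open>j\<close>-th chart of \<open>M\<close>).
\<close>

definition lb_iso ::
  "('x, 'k::field) fun_space \<Rightarrow> ('i, 'x, 'k) lbundle \<Rightarrow> ('j, 'x, 'k) lbundle \<Rightarrow> bool" where
  "lb_iso X L M \<longleftrightarrow> (\<exists>a.
     (\<forall>i j. regular X (cover L i \<inter> cover M j) (a i j)) \<and>
     (\<forall>i j. \<forall>x \<in> cover L i \<inter> cover M j. a i j x \<noteq> 0) \<and>
     (\<forall>i i' j j'. \<forall>x \<in> cover L i \<inter> cover L i' \<inter> cover M j \<inter> cover M j'.
        a i j x * transition L i i' x = transition M j j' x * a i' j' x))"

definition pullback ::
  "('y, 'k) fun_space \<Rightarrow> ('y \<Rightarrow> 'x) \<Rightarrow> ('i, 'x, 'k) lbundle \<Rightarrow> ('i, 'y, 'k) lbundle" where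
  "pullback Y f L =
     \<lparr>cover = (\<lambda>i. {y \<in> points Y. f y \<in> cover L i}),
      transition = (\<lambda>i j y. transition L i j (f y))\<rparr>"

text \<open>Sections are normalized to vanish outside the charts, so that they are determined by their
  values on the charts and form a subspace of a function space.\<close>

definition sections ::
  "('x, 'k::field) fun_space \<Rightarrow> ('i, 'x, 'k) lbundle \<Rightarrow> ('i \<Rightarrow> 'x \<Rightarrow> 'k) set" where
  "sections X L = {s.
     (\<forall>i. regular X (cover L i) (s i)) \<and>
     (\<forall>i x. x \<notin> cover L i \<longrightarrow> s i x = 0) \<and>
     (\<forall>i j. \<forall>x \<in> cover L i \<inter> cover L j. s i x = transition L i j x * s j x)}"

definition scale_sec :: "'k::field \<Rightarrow> ('i \<Rightarrow> 'x \<Rightarrow> 'k) \<Rightarrow> 'i \<Rightarrow> 'x \<Rightarrow> 'k" where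
  "scale_sec c s = (\<lambda>i x. c * s i x)"

lemma vector_space_scale_sec: "vector_space (scale_sec :: 'k::field \<Rightarrow> ('i \<Rightarrow> 'x \<Rightarrow> 'k) \<Rightarrow> _)"
  by unfold_locales (auto simp: scale_sec_def fun_eq_iff algebra_simps)

definition h0 :: "('x, 'k::field) fun_space \<Rightarrow> ('i, 'x, 'k) lbundle \<Rightarrow> nat" where
  "h0 X L = vector_space.dim scale_sec (sections X L)"

text \<open>The library's dimension of an infinite-dimensional space is \<open>0\<close>, so finiteness is
  recorded separately.\<close>

definition finite_h0 :: "('x, 'k::field) fun_space \<Rightarrow> ('i, 'x, 'k) lbundle \<Rightarrow> bool" where
  "finite_h0 X L \<longleftrightarrow> (\<exists>B. finite B \<and> module.span scale_sec B = sections X L)"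

text \<open>
  \<open>\<O>(n)\<close> on the projective line: charts \<open>x \<noteq> 0\<close> (index \<open>False\<close>) and \<open>y \<noteq> 0\<close> (index \<open>True\<close>); a form
  \<open>F\<close> of degree \<open>n\<close> is the section with components \<open>F / x\<^sup>n\<close> and \<open>F / y\<^sup>n\<close>.
\<close>

definition hcoord :: "bool \<Rightarrow> 'k::field proj1 \<Rightarrow> 'k" where
  "hcoord b p = (if b then snd (rep_proj1 p) else fst (rep_proj1 p))"

definition O_twist :: "int \<Rightarrow> (bool, 'k::field proj1, 'k) lbundle" where
  "O_twist n =
     \<lparr>cover = (\<lambda>b. {p. hcoord b p \<noteq> 0}),
      transition = (\<lambda>b b' p. (hcoord b' p / hcoord b p) powi n)\<rparr>"

section \<open>Nodal curves with rational components\<close>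

text \<open>
  \<open>J\<close> is the set of component labels and \<open>R\<close> a set of pairwise disjoint two-element sets
  \<open>{(i, p), (j, q)}\<close> of points of the disjoint union of projective lines \<open>J \<times> \<P>\<^sup>1\<close>. The curve is the
  quotient in which the two points of each member of \<open>R\<close> are identified to an ordinary node. A
  point of the curve is the set of points of the disjoint union lying over it. A function is
  regular iff its pullback to each component is, i.e. the local ring at a node consists of all
  pairs of germs on the two branches having the same value (so its completion is
  \<open>k[[x, y]] / (xy)\<close>).
\<close>

definition glue_class :: "('j \<times> 'k::field proj1) set set \<Rightarrow> 'j \<times> 'k proj1 \<Rightarrow> ('j \<times> 'k proj1) set" where
  "glue_class R b = insert b (\<Union>{r \<in> R. b \<in> r})"

definition comp_map :: "('j \<times> 'k::field proj1) set set \<Rightarrow> 'j \<Rightarrow> 'k proj1 \<Rightarrow> ('j \<times> 'k proj1) set" where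
  "comp_map R j p = glue_class R (j, p)"

definition glue_open ::
  "'j set \<Rightarrow> ('j \<times> 'k::field proj1) set set \<Rightarrow> ('j \<times> 'k proj1) set set \<Rightarrow> bool" where
  "glue_open J R U \<longleftrightarrow>
     U \<subseteq> glue_class R ` (J \<times> UNIV) \<and> (\<forall>j\<in>J. openin (zariski P1) (comp_map R j -` U))"

lemma istopology_glue_open: "istopology (glue_open J R)"
proof -
  have "glue_open J R (U \<inter> V)" if "glue_open J R U" "glue_open J R V" for U V
    using that by (auto simp: glue_open_def)
  moreover have "glue_open J R (\<Union>\<U>)" if "\<forall>U\<in>\<U>. glue_open J R U" for \<U>
    using that by (auto simp: glue_open_def vimage_Union)
  ultimately show ?thesis
    by (simp add: istopology_def)
qed

definition glue :: "'j set \<Rightarrow> ('j \<times> 'k::field proj1) set set \<Rightarrow> (('j \<times> 'k proj1) set, 'k) fun_space" where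
  "glue J R =
     \<lparr>zariski = topology (glue_open J R),
      regular = (\<lambda>U f. \<forall>j\<in>J. regular P1 (comp_map R j -` U) (\<lambda>p. f (comp_map R j p)))\<rparr>"

text \<open>The degree of \<open>L\<close> on the component \<open>j\<close> is \<open>n\<close>, i.e. \<open>L\<close> restricts to \<open>\<O>(n)\<close> there.\<close>

definition has_degree ::
  "('j \<times> 'k::field proj1) set set \<Rightarrow> ('i, ('j \<times> 'k proj1) set, 'k) lbundle \<Rightarrow> 'j \<Rightarrow> int \<Rightarrow> bool" where
  "has_degree R L j n \<longleftrightarrow> lb_iso P1 (pullback P1 (comp_map R j) L) (O_twist n)"

section \<open>Binary curves\<close>

text \<open>
  With coordinates chosen on \<open>C1\<close> and \<open>C2\<close>, a binary curve is given by the set of its nodes; the node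
  \<open>(p, q)\<close> joins the point \<open>p\<close> of \<open>C1\<close> to the point \<open>q\<close> of \<open>C2\<close>.
  The labels \<open>E \<nu>\<close> are used for the exceptional components of blow-ups.
\<close>

type_synonym 'k node = "'k proj1 \<times> 'k proj1"

datatype 'k component = C1 | C2 | E 'k

type_synonym 'k cpoint = "('k node component \<times> 'k proj1) set"

type_synonym ('i, 'k) curve_lbundle = "('i, 'k cpoint, 'k) lbundle"

definition binary_nodes :: "'k::field node set \<Rightarrow> bool" where
  "binary_nodes N \<longleftrightarrow> finite N \<and> inj_on fst N \<and> inj_on snd N"

definition genus :: "'k::field node set \<Rightarrow> int" where
  "genus N = int (card N) - 1"

definition binary_ident :: "'k::field node set \<Rightarrow> ('k node component \<times> 'k proj1) set set" where
  "binary_ident N = (\<lambda>(p, q). {(C1, p), (C2, q)}) ` N"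

definition binary_curve :: "'k::field node set \<Rightarrow> ('k cpoint, 'k) fun_space" where
  "binary_curve N = glue {C1, C2} (binary_ident N)"

definition balanced :: "int \<Rightarrow> int \<times> int \<Rightarrow> bool" where
  "balanced g md \<longleftrightarrow> (let d = fst md + snd md in \<forall>e \<in> {fst md, snd md}.
     real_of_int (d - g - 1) / 2 \<le> real_of_int e \<and> real_of_int e \<le> real_of_int (d + g + 1) / 2)"

definition strictly_balanced :: "int \<Rightarrow> int \<times> int \<Rightarrow> bool" where
  "strictly_balanced g md \<longleftrightarrow> (let d = fst md + snd md in \<forall>e \<in> {fst md, snd md}.
     real_of_int (d - g - 1) / 2 < real_of_int e \<and> real_of_int e < real_of_int (d + g + 1) / 2)"

definition has_multidegree ::
  "'k::field node set \<Rightarrow> ('i, 'k) curve_lbundle \<Rightarrow> int \<times> int \<Rightarrow> bool" where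
  "has_multidegree N L md \<longleftrightarrow>
     has_degree (binary_ident N) L C1 (fst md) \<and> has_degree (binary_ident N) L C2 (snd md)"

definition balanced_lb :: "'k::field node set \<Rightarrow> int \<Rightarrow> ('i, 'k) curve_lbundle \<Rightarrow> bool" where
  "balanced_lb N d L \<longleftrightarrow> line_bundle (binary_curve N) L \<and>
     (\<exists>md. has_multidegree N L md \<and> fst md + snd md = d \<and> balanced (genus N) md)"

definition strictly_balanced_lb :: "'k::field node set \<Rightarrow> int \<Rightarrow> ('i, 'k) curve_lbundle \<Rightarrow> bool" where
  "strictly_balanced_lb N d L \<longleftrightarrow> line_bundle (binary_curve N) L \<and>
     (\<exists>md. has_multidegree N L md \<and> fst md + snd md = d \<and> strictly_balanced (genus N) md)"

section \<open>Blow-ups and the compactified Picard variety\<close>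

text \<open>
  The normalization at \<open>S\<close> is \<open>Y\<^sub>S = binary_curve (N - S)\<close>. In the blow-up at \<open>S\<close>, the exceptional
  component \<open>E (p, q)\<close> meets \<open>C1\<close> at \<open>p\<close> in its point \<open>0\<close>, and \<open>C2\<close> at \<open>q\<close> in its point \<open>\<infinity>\<close>.
\<close>

definition blowup_ident ::
  "'k::field node set \<Rightarrow> 'k node set \<Rightarrow> ('k node component \<times> 'k proj1) set set" where
  "blowup_ident N S = binary_ident (N - S) \<union>
     (\<Union>(p, q)\<in>S. {{(C1, p), (E (p, q), pt_zero)}, {(C2, q), (E (p, q), pt_infty)}})"

definition blowup :: "'k::field node set \<Rightarrow> 'k node set \<Rightarrow> ('k cpoint, 'k) fun_space" where
  "blowup N S = glue ({C1, C2} \<union> E ` S) (blowup_ident N S)"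

text \<open>The restriction to \<open>Y\<^sub>S\<close>, along the inclusion sending a point of \<open>Y\<^sub>S\<close> to the class
  in the blow-up of the point or points of \<open>C1\<close> and \<open>C2\<close> lying over it.\<close>

definition restrict_Y ::
  "'k::field node set \<Rightarrow> 'k node set \<Rightarrow> ('i, 'k) curve_lbundle \<Rightarrow> ('i, 'k) curve_lbundle" where
  "restrict_Y N S L =
     pullback (binary_curve (N - S)) (\<lambda>P. \<Union>b\<in>P. glue_class (blowup_ident N S) b) L"

text \<open>Pairs \<open>(S, L)\<close>, with \<open>L\<close> on the blow-up at \<open>S\<close>, representing points of the compactified Picard
  variety. The degree of \<open>L\<close> is that of its restriction to \<open>Y\<^sub>S\<close> plus the number of exceptional
  components.\<close>

definition picbar_sb_reps ::
  "'k::field node set \<Rightarrow> int \<Rightarrow> ('k node set \<times> ('i, 'k) curve_lbundle) set" where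
  "picbar_sb_reps N d = {(S, L). S \<subseteq> N \<and> line_bundle (blowup N S) L \<and>
     (\<forall>\<nu>\<in>S. has_degree (blowup_ident N S) L (E \<nu>) 1) \<and>
     strictly_balanced_lb (N - S) (d - int (card S)) (restrict_Y N S L)}"

definition picbar_l0_reps ::
  "'k::field node set \<Rightarrow> int \<Rightarrow> ('k node set \<times> ('i, 'k) curve_lbundle) set" where
  "picbar_l0_reps N d = {(S, L). S = N \<and> line_bundle (blowup N S) L \<and>
     (\<forall>\<nu>\<in>S. has_degree (blowup_ident N S) L (E \<nu>) 1) \<and>
     (\<exists>m. 2 * m = d - genus N - 1 \<and> has_multidegree (N - S) (restrict_Y N S L) (m, m))}"

definition picbar_equiv ::
  "'k::field node set \<Rightarrow> int \<Rightarrow>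
   (('k node set \<times> ('i, 'k) curve_lbundle) \<times> ('k node set \<times> ('i, 'k) curve_lbundle)) set" where
  "picbar_equiv N d = {((S, L), (S', L')).
     (S, L) \<in> picbar_sb_reps N d \<union> picbar_l0_reps N d \<and>
     (S', L') \<in> picbar_sb_reps N d \<union> picbar_l0_reps N d \<and>
     S = S' \<and> lb_iso (binary_curve (N - S)) (restrict_Y N S L) (restrict_Y N S L')}"

definition compactified_Pic ::
  "'k::field node set \<Rightarrow> int \<Rightarrow> ('k node set \<times> ('i, 'k) curve_lbundle) set set" where
  "compactified_Pic N d = (picbar_sb_reps N d \<union> picbar_l0_reps N d) // picbar_equiv N d"

end

theory Submission
  imports Defs
begin

text \<open>
  A section of a line bundle restricting to \<open>\<O>(d\<^sub>j)\<close> on the \<open>j\<close>-th component is a family of binary forms of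
  degrees \<open>d\<^sub>j \<ge> -1\<close> satisfying one linear condition, with nonzero coefficients on both branches, at each
  node. The space of forms has dimension \<open>\<Sum>j. d\<^sub>j + 1\<close>, so it remains to see that the conditions are
  independent. At an exceptional component a linear form with prescribed values at both ends does this. For the
  \<open>n\<close> nodes joining \<open>C\<^sub>1\<close> and \<open>C\<^sub>2\<close>, the bound \<open>d \<ge> 2g - 1\<close> gives a component of degree at least
  \<open>g = n - 1\<close>, on which a form can vanish at all nodes but one; balancedness enters only through
  \<open>d\<^sub>1, d\<^sub>2 \<ge> -1\<close>. For a blow-up, \<open>d\<close>, \<open>g\<close> and \<open>n\<close> refer to the partial normalization.
\<close>

section \<open>Dimension counting by functionals\<close>

text \<open>Sections consist of functions that are only locally quotients of forms, in charts
  unrelated to the coordinates on the components. The main obstacle is to recognise them as global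
  forms. Algebraic closedness enters there: denominators have roots to cancel, and the field is
  infinite, so a polynomial is determined by its values outside a finite set.

  Independence on a blow-up is triangular: forms on the exceptional components do not affect the
  nodes joining C1 and C2, whereas forms on C1 and C2 also disturb the conditions at the exceptional
  points. Hence the nodes are treated first, and the exceptional conditions are imposed on their
  kernel. Each exceptional component adds two dimensions and two conditions, and
  \<open>d - g + 1\<close> is unchanged when \<open>d\<close> and \<open>g\<close> both drop by the
  number of blown-up nodes.

  Both numerical bounds need integrality: \<open>d \<ge> 2g - 1\<close> by itself makes the larger
  degree at least g - 1/2, and balancedness makes each degree at least -3/2.\<close>

locale dimension_count = vector_space
begin

text \<open>A finite basis is part of the notion: \<open>dim\<close> alone gives 0 on
  infinite-dimensional spaces, and the finiteness of the space of sections must come out of the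
  count as well.\<close>

definition has_dim :: "'b set \<Rightarrow> nat \<Rightarrow> bool" where
  "has_dim U n \<longleftrightarrow> (\<exists>B. finite B \<and> independent B \<and> span B = U \<and> card B = n)"

lemma has_dim_dim: "has_dim U n \<Longrightarrow> dim U = n"
  unfolding has_dim_def using dim_span dim_eq_card_independent by metis

lemma has_dim_zero: "has_dim {0} 0"
  unfolding has_dim_def by (intro exI[of _ "{}"]) (simp add: independent_empty)

lemma has_dim_subspace:
  assumes "has_dim U n" "subspace K" "K \<subseteq> U"
  shows "\<exists>m. has_dim K m"
proof -
  obtain B where B: "finite B" "span B = U"
    using assms(1) unfolding has_dim_def by blast
  obtain C where C: "C \<subseteq> K" "independent C" "K \<subseteq> span C"
    using maximal_independent_subset[of K] by blast
  have "C \<subseteq> span B"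
    using C(1) assms(3) B(2) by blast
  then have "finite C"
    using independent_span_bound[OF B(1) C(2)] by blast
  moreover have "span C = K"
    using C assms(2) by (intro span_subspace)
  ultimately show ?thesis
    using C(2) unfolding has_dim_def by blast
qed

definition functional_on :: "'b set \<Rightarrow> ('b \<Rightarrow> 'a) \<Rightarrow> bool" where
  "functional_on U \<phi> \<longleftrightarrow>
     (\<forall>x\<in>U. \<forall>y\<in>U. \<phi> (x + y) = \<phi> x + \<phi> y) \<and> (\<forall>x\<in>U. \<forall>c. \<phi> (c *s x) = c * \<phi> x)"

lemma functional_on_subset: "functional_on U \<phi> \<Longrightarrow> K \<subseteq> U \<Longrightarrow> functional_on K \<phi>"
  unfolding functional_on_def by blast

lemma subspace_functional_kernel:
  assumes "subspace U" "functional_on U \<phi>"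
  shows "subspace {x \<in> U. \<phi> x = 0}"
proof -
  have "\<phi> 0 = 0"
    using assms subspace_0[of U] unfolding functional_on_def
    by (metis mult_zero_left scale_zero_left)
  then show ?thesis
    using assms unfolding functional_on_def subspace_def by auto
qed

text \<open>Subtracting a multiple of \<open>w\<close> moves any vector of \<open>U\<close> into the
  kernel, so a basis of the kernel together with \<open>w\<close> is a basis of
  \<open>U\<close>.\<close>

lemma has_dim_kernel_Suc:
  assumes U: "subspace U" and \<phi>: "functional_on U \<phi>"
    and w: "w \<in> U" "\<phi> w \<noteq> 0" and K: "has_dim {x \<in> U. \<phi> x = 0} n"
  shows "has_dim U (Suc n)"
proof -
  obtain B where B: "finite B" "independent B" "span B = {x \<in> U. \<phi> x = 0}" "card B = n"
    using K unfolding has_dim_def by blast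
  have notin: "w \<notin> span B"
    using B(3) w by simp
  have "span (insert w B) = U"
  proof (rule span_subspace)
    show "insert w B \<subseteq> U"
      using w(1) span_superset[of B] B(3) by auto
    show "U \<subseteq> span (insert w B)"
    proof
      fix x assume x: "x \<in> U"
      define c where "c = \<phi> x / \<phi> w"
      have "x - c *s w \<in> U"
        using U x w(1) by (simp add: subspace_diff subspace_scale)
      moreover have "\<phi> (x - c *s w) = \<phi> x + \<phi> ((- c) *s w)"
        using \<phi> x w(1) subspace_scale[OF U w(1), of "- c"] unfolding functional_on_def
        by (metis diff_conv_add_uminus scale_minus_left)
      moreover have "\<phi> ((- c) *s w) = - c * \<phi> w"
        using \<phi> w(1) unfolding functional_on_def by blast
      ultimately have "x - c *s w \<in> span B"
        using B(3) w(2) by (simp add: c_def)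
      then show "x \<in> span (insert w B)"
        using span_breakdown_eq by blast
    qed
  qed (rule U)
  moreover have "card (insert w B) = Suc n"
    using B notin span_base by (metis card_insert_disjoint)
  ultimately show ?thesis
    unfolding has_dim_def using B(1) independent_insertI[OF notin B(2)]
    by (metis finite_insert)
qed

text \<open>The witnesses form a dual family: the one for \<open>s\<close> is killed by every other
  functional, so it survives in the kernel of \<open>\<phi> r\<close>, and the functionals can be
  split off one at a time.\<close>

lemma has_dim_from_kernel:
  assumes "finite R" "subspace U" "\<And>r. r \<in> R \<Longrightarrow> functional_on U (\<phi> r)"
    and "\<And>r. r \<in> R \<Longrightarrow> \<exists>w\<in>U. \<phi> r w \<noteq> 0 \<and> (\<forall>s\<in>R. s \<noteq> r \<longrightarrow> \<phi> s w = 0)"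
    and "has_dim {x \<in> U. \<forall>r\<in>R. \<phi> r x = 0} n"
  shows "has_dim U (n + card R)"
  using assms
proof (induction R arbitrary: U rule: finite_induct)
  case empty
  then show ?case by simp
next
  case (insert r R)
  let ?U = "{x \<in> U. \<phi> r x = 0}"
  have "has_dim ?U (n + card R)"
  proof (rule insert.IH)
    show "subspace ?U"
      using insert.prems by (intro subspace_functional_kernel) auto
    show "functional_on ?U (\<phi> s)" if "s \<in> R" for s
      using that insert.prems(2)[of s] by (auto intro: functional_on_subset)
    show "\<exists>w\<in>?U. \<phi> s w \<noteq> 0 \<and> (\<forall>t\<in>R. t \<noteq> s \<longrightarrow> \<phi> t w = 0)" if "s \<in> R" for s
    proof -
      have "s \<noteq> r"
        using that insert.hyps by blast
      then show ?thesis
        using that insert.prems(3)[of s] by auto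
    qed
    show "has_dim {x \<in> ?U. \<forall>r\<in>R. \<phi> r x = 0} n"
      using insert.prems(4) by (simp add: conj_assoc)
  qed
  then have "has_dim U (Suc (n + card R))"
    using insert.prems(1,2) insert.prems(3)[of r] by (metis has_dim_kernel_Suc insertI1)
  then show ?case
    using insert.hyps by simp
qed

text \<open>The same count read backwards: as a subspace of \<open>U\<close> the kernel has some
  finite dimension, and the known dimension of \<open>U\<close> then determines it.\<close>

lemma has_dim_kernel:
  assumes R: "finite R" and U: "subspace U" and \<phi>: "\<And>r. r \<in> R \<Longrightarrow> functional_on U (\<phi> r)"
    and dual: "\<And>r. r \<in> R \<Longrightarrow> \<exists>w\<in>U. \<phi> r w \<noteq> 0 \<and> (\<forall>s\<in>R. s \<noteq> r \<longrightarrow> \<phi> s w = 0)"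
    and dim: "has_dim U (n + card R)"
  shows "has_dim {x \<in> U. \<forall>r\<in>R. \<phi> r x = 0} n"
proof -
  let ?K = "{x \<in> U. \<forall>r\<in>R. \<phi> r x = 0}"
  have "subspace (U \<inter> (\<Inter>r\<in>R. {x \<in> U. \<phi> r x = 0}))"
    using U \<phi> by (intro subspace_inter subspace_Int subspace_functional_kernel)
  also have "U \<inter> (\<Inter>r\<in>R. {x \<in> U. \<phi> r x = 0}) = ?K"
    by auto
  finally obtain m where m: "has_dim ?K m"
    using has_dim_subspace[OF dim] by blast
  have "has_dim U (m + card R)"
    using R U \<phi> dual m by (rule has_dim_from_kernel)
  then have "m = n"
    using has_dim_dim[OF dim] has_dim_dim[of U "m + card R"] by simp
  then show ?thesis
    using m by simp
qed

end

text \<open>Injectivity is asked on \<open>U\<close> only, because the map later applied to sections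
  ignores most values of an arbitrary family of functions. A basis of the image is lifted to
  \<open>U\<close>.\<close>

lemma has_dim_linear_inj:
  assumes \<Phi>: "Vector_Spaces.linear s1 s2 \<Phi>" and U: "module.subspace s1 U" and inj: "inj_on \<Phi> U"
    and dim: "dimension_count.has_dim s2 (\<Phi> ` U) n"
  shows "dimension_count.has_dim s1 U n"
proof -
  have "vector_space s1" "vector_space s2"
    using \<Phi> unfolding Vector_Spaces.linear_iff by blast+
  then interpret V1: dimension_count s1 + V2: dimension_count s2
    by (simp_all add: dimension_count_def)
  interpret \<Phi>: Vector_Spaces.linear s1 s2 \<Phi> by (rule \<Phi>)
  obtain C where C: "finite C" "\<not> V2.dependent C" "V2.span C = \<Phi> ` U" "card C = n"
    using dim unfolding V2.has_dim_def by blast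
  obtain B where B: "B \<subseteq> U" "C = \<Phi> ` B"
    using C(3) V2.span_superset[of C] by (metis subset_image_iff)
  have injB: "inj_on \<Phi> B"
    using inj B(1) by (rule inj_on_subset)
  have sub: "V1.span B \<subseteq> U"
    using B(1) U by (rule V1.span_minimal)
  have "finite B"
    using C(1) B(2) injB by (simp add: finite_image_iff)
  moreover have "\<not> V1.dependent B"
  proof
    assume "V1.dependent B"
    then obtain b where b: "b \<in> B" "b \<in> V1.span (B - {b})"
      unfolding V1.dependent_def by (elim bexE)
    have "\<Phi> ` (B - {b}) = \<Phi> ` B - \<Phi> ` {b}"
      using b(1) by (intro inj_on_image_set_diff[OF injB]) auto
    then have "\<Phi> b \<in> V2.span (C - {\<Phi> b})"
      using imageI[OF b(2), of \<Phi>] \<Phi>.span_image[of "B - {b}"] unfolding B(2) by simp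
    moreover have "\<Phi> b \<in> C"
      unfolding B(2) using b(1) by (rule imageI)
    ultimately have "V2.dependent C"
      unfolding V2.dependent_def by (rule bexI)
    then show False
      using C(2) by simp
  qed
  moreover have "U \<subseteq> V1.span B"
  proof
    fix x assume x: "x \<in> U"
    then have "\<Phi> x \<in> \<Phi> ` V1.span B"
      using C(3) B(2) \<Phi>.span_image by auto
    then show "x \<in> V1.span B"
      using inj_on_image_mem_iff[OF inj x sub] by blast
  qed
  moreover have "card B = n"
    using C(4) B(2) card_image[OF injB] by simp
  ultimately show ?thesis
    unfolding V1.has_dim_def using sub by (intro exI[of _ B]) simp
qed

section \<open>Rational functions without poles\<close>

text \<open>Euclid's argument: the product of all factors \<open>t - a\<close>, plus one, would be a
  nonconstant polynomial without roots.\<close>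

lemma infinite_UNIV_alg_closed: "infinite (UNIV :: 'k::alg_closed_field set)"
proof
  assume fin: "finite (UNIV :: 'k set)"
  define p :: "'k poly" where "p = (\<Prod>a\<in>UNIV. [:- a, 1:]) + 1"
  have "degree (\<Prod>a\<in>UNIV. [:- a, 1:] :: 'k poly) = card (UNIV :: 'k set)"
    by (subst degree_prod_eq_sum_degree) auto
  moreover have "card (UNIV :: 'k set) > 0"
    using fin by (simp add: card_gt_0_iff)
  ultimately have "degree p > 0"
    unfolding p_def by (subst degree_add_eq_left) auto
  then obtain x where "poly p x = 0"
    using alg_closed_imp_poly_has_root by blast
  moreover have "poly p x = 1"
    using fin by (simp add: p_def poly_prod prod_zero)
  ultimately show False by simp
qed

lemma poly_eq_if_cofinite_eq:
  fixes p q :: "'k::alg_closed_field poly"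
  assumes "finite {t. poly p t \<noteq> poly q t}"
  shows "p = q"
proof (rule ccontr)
  assume "p \<noteq> q"
  then have "finite {t. poly (p - q) t = 0}"
    by (intro poly_roots_finite) auto
  then have "finite ({t. poly p t \<noteq> poly q t} \<union> {t. poly (p - q) t = 0})"
    using assms by simp
  moreover have "{t. poly p t \<noteq> poly q t} \<union> {t. poly (p - q) t = 0} = UNIV"
    by auto
  ultimately show False
    using infinite_UNIV_alg_closed by metis
qed

text \<open>A fraction representing \<open>f\<close> near one point is freed of its denominator: as
  \<open>f\<close> is finite everywhere, a root of the denominator is a root of the numerator, and
  linear factors cancel until the denominator is constant.\<close>

lemma locally_rational_imp_polynomial:
  fixes f :: "'k::alg_closed_field \<Rightarrow> 'k"
  assumes loc: "\<And>t. \<exists>C a b. t \<in> C \<and> finite (- C) \<and>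
      (\<forall>s\<in>C. poly b s \<noteq> 0 \<and> f s = poly a s / poly b s)"
  shows "\<exists>p. \<forall>t. f t = poly p t"
proof -
  \<comment> \<open>Rigidity: if \<open>f * b = a\<close> outside a finite set, then
    \<open>a / b\<close> and the local fraction \<open>a' / b'\<close> at \<open>t\<close> agree as
    fractions of polynomials. Since \<open>b'\<close> does not vanish at \<open>t\<close>, the
    relation holds at \<open>t\<close> as well.\<close>
  have everywhere: "f t * poly b t = poly a t"
    if cof: "finite {s. f s * poly b s \<noteq> poly a s}" for a b t
  proof -
    obtain C a' b' where C: "t \<in> C" "finite (- C)"
      and f: "\<And>s. s \<in> C \<Longrightarrow> poly b' s \<noteq> 0 \<and> f s = poly a' s / poly b' s"
      using loc[of t] by blast
    have "{s. poly (a' * b) s \<noteq> poly (a * b') s} \<subseteq> {s. f s * poly b s \<noteq> poly a s} \<union> - C"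
      using f by (auto simp: field_simps)
    then have "a' * b = a * b'"
      using cof C(2) by (intro poly_eq_if_cofinite_eq) (meson finite_UnI finite_subset)
    then have "poly a' t * poly b t = poly a t * poly b' t"
      by (metis poly_mult)
    then show ?thesis
      using f[OF C(1)] by (simp add: field_simps)
  qed
  have descent: "\<exists>p. \<forall>t. f t = poly p t"
    if "b \<noteq> 0" "\<forall>s. f s * poly b s = poly a s" for a b
    using that
  proof (induction "degree b" arbitrary: a b)
    case 0
    then obtain c where c: "b = [:c:]"
      using degree_eq_zeroE by metis
    then have "f t = poly (smult (inverse c) a) t" for t
      using 0 by (auto simp: field_simps dest: spec[of _ t])
    then show ?case by blast
  next
    case (Suc n)
    then obtain z where z: "poly b z = 0"
      using alg_closed_imp_poly_has_root[of b] by auto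
    then have az: "poly a z = 0"
      using Suc.prems(2) by (metis mult_zero_right)
    obtain b' where b': "b = [:- z, 1:] * b'"
      using z by (auto simp: poly_eq_0_iff_dvd)
    obtain a' where a': "a = [:- z, 1:] * a'"
      using az by (auto simp: poly_eq_0_iff_dvd)
    have b'0: "b' \<noteq> 0"
      using Suc.prems(1) b' by auto
    then have deg: "n = degree b'"
      using Suc.hyps(2) degree_mult_eq[of "[:- z, 1:]" b'] unfolding b'
    by (simp del: mult_pCons_left)
    have "f s * poly b' s = poly a' s" if "s \<noteq> z" for s
    proof -
      have "(s - z) * (f s * poly b' s) = (s - z) * poly a' s"
        using Suc.prems(2) by (simp add: a' b' algebra_simps)
      then show ?thesis
        using that by simp
    qed
    \<comment> \<open>Cancelling the factor loses the relation at \<open>z\<close> only, and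
      rigidity restores it there.\<close>
    then have "{s. f s * poly b' s \<noteq> poly a' s} \<subseteq> {z}"
      by blast
    then have "\<forall>s. f s * poly b' s = poly a' s"
      using everywhere finite_subset by blast
    then show ?case
      using Suc.hyps(1)[OF deg b'0] by blast
  qed
  obtain C a b where C: "finite (- C)" "0 \<in> C"
    and f: "\<And>s. s \<in> C \<Longrightarrow> poly b s \<noteq> 0 \<and> f s = poly a s / poly b s"
    using loc[of 0] by blast
  have "{s. f s * poly b s \<noteq> poly a s} \<subseteq> - C"
    using f by auto
  then have "\<forall>s. f s * poly b s = poly a s"
    using everywhere C(1) finite_subset by blast
  moreover have "b \<noteq> 0"
    using f C(2) by auto
  ultimately show ?thesis
    using descent by blast
qed

section \<open>Regular functions on the projective line\<close>

abbreviation xc :: "'k::field proj1 \<Rightarrow> 'k" where "xc p \<equiv> fst (rep_proj1 p)"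
abbreviation yc :: "'k::field proj1 \<Rightarrow> 'k" where "yc p \<equiv> snd (rep_proj1 p)"

section \<open>Homogeneous coordinates and affine charts\<close>

lemma rep_proj1_nonzero: "rep_proj1 p \<noteq> (0, 0)"
  using Quotient_rep_reflp[OF Quotient_proj1, of p] by simp

lemma coords_nonzero: "xc p \<noteq> 0 \<or> yc p \<noteq> 0"
  using rep_proj1_nonzero[of p] by (cases "rep_proj1 p") auto

lemma proj1_eq_iff: "p = q \<longleftrightarrow> xc p * yc q = yc p * xc q"
  using Quotient_rel_rep[OF Quotient_proj1, of p q] rep_proj1_nonzero[of p] rep_proj1_nonzero[of q]
  by auto

text \<open>The representative chosen by \<open>rep_proj1\<close> is unknown, so homogeneous
  coordinates can be computed only up to the factor \<open>l\<close>.\<close>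

lemma rep_abs_proj1:
  assumes "(u, v) \<noteq> (0, 0)"
  obtains l where "l \<noteq> 0" "xc (abs_proj1 (u, v)) = l * u" "yc (abs_proj1 (u, v)) = l * v"
proof -
  have eq: "xc (abs_proj1 (u, v)) * v = yc (abs_proj1 (u, v)) * u"
    using Quotient_rep_abs[OF Quotient_proj1, of "(u, v)"] assms by simp
  define p where "p = abs_proj1 (u, v)"
  define l where "l = (if u \<noteq> 0 then xc p / u else yc p / v)"
  have "xc p = l * u" "yc p = l * v"
    using eq assms unfolding l_def p_def[symmetric] by (auto simp: field_simps)
  moreover have "l \<noteq> 0"
    using coords_nonzero[of p] calculation by auto
  ultimately show ?thesis
    using that p_def by blast
qed

text \<open>The inverse of the affine coordinate \<open>hcoord (\<not> b) p / hcoord b p\<close> on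
  the chart \<open>hcoord b p \<noteq> 0\<close>.\<close>

definition affine :: "bool \<Rightarrow> 'k::field \<Rightarrow> 'k proj1" where
  "affine b t = abs_proj1 (if b then (t, 1) else (1, t))"

lemma affine_coords:
  obtains l where "l \<noteq> 0" "hcoord b (affine b t) = l" "hcoord (\<not> b) (affine b t) = l * t"
proof (cases b)
  case True
  obtain l where "l \<noteq> 0" "xc (affine True t) = l * t" "yc (affine True t) = l * 1"
    using rep_abs_proj1[of t 1] unfolding affine_def by auto
  then show ?thesis
    using that True by (simp add: hcoord_def)
next
  case False
  obtain l where "l \<noteq> 0" "xc (affine False t) = l * 1" "yc (affine False t) = l * t"
    using rep_abs_proj1[of 1 t] unfolding affine_def by auto
  then show ?thesis
    using that False by (simp add: hcoord_def)
qed

lemma affine_hcoord: "hcoord b (affine b t) \<noteq> 0"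
  using affine_coords[of b t] by metis

lemma affine_ratio: "hcoord (\<not> b) (affine b t) / hcoord b (affine b t) = t"
  using affine_coords[of b t] by (metis nonzero_mult_div_cancel_left)

lemma affine_of_ratio:
  assumes "hcoord b p \<noteq> 0"
  shows "affine b (hcoord (\<not> b) p / hcoord b p) = p"
proof -
  obtain l where "hcoord b (affine b (hcoord (\<not> b) p / hcoord b p)) = l"
    "hcoord (\<not> b) (affine b (hcoord (\<not> b) p / hcoord b p)) = l * (hcoord (\<not> b) p / hcoord b p)"
    by (rule affine_coords)
  then show ?thesis
    using assms by (cases b) (auto simp: proj1_eq_iff[of _ p] hcoord_def field_simps)
qed

lemma inj_affine: "inj (affine b)"
  by (metis affine_ratio injI)

lemma hcoord_some_nonzero: "\<exists>b. hcoord b p \<noteq> 0"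
  using coords_nonzero[of p] unfolding hcoord_def by (metis (full_types))

lemma affine_swap: "t \<noteq> 0 \<Longrightarrow> affine b t = affine (\<not> b) (inverse t)"
  by (smt (verit) affine_coords affine_of_ratio affine_ratio divide_eq_0_iff inverse_divide mult_eq_0_iff)

lemma pt_zero_neq_pt_infty: "(pt_zero :: 'k::field proj1) \<noteq> pt_infty"
proof
  assume eq: "(pt_zero :: 'k proj1) = pt_infty"
  have 0: "(pt_zero :: 'k proj1) = abs_proj1 (0, 1)" and i: "(pt_infty :: 'k proj1) = abs_proj1 (1, 0)"
    by (simp_all add: pt_zero.abs_eq pt_infty.abs_eq)
  obtain l where "l \<noteq> 0" "xc (pt_zero :: 'k proj1) = l * 0"
    using rep_abs_proj1[of "0 :: 'k" 1] unfolding 0 by auto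
  moreover obtain m where "m \<noteq> 0" "xc (pt_infty :: 'k proj1) = m * 1"
    using rep_abs_proj1[of "1 :: 'k" 0] unfolding i by auto
  ultimately show False
    using eq by simp
qed

subsection \<open>Binary forms\<close>

lemma form_eval_poly_if_y: "yc p \<noteq> 0 \<Longrightarrow> form_eval n c p = yc p ^ n * (\<Sum>i\<le>n. c i * (xc p / yc p) ^ i)"
  unfolding form_eval_def sum_distrib_left
  by (intro sum.cong refl) (simp add: power_divide power_diff)

lemma form_eval_if_y_zero: "yc p = 0 \<Longrightarrow> form_eval n c p = c n * xc p ^ n"
proof -
  assume y: "yc p = 0"
  \<comment> \<open>The last term survives because \<open>0 ^ 0 = 1\<close>.\<close>
  have "form_eval n c p = (\<Sum>i\<le>n. if i = n then c n * xc p ^ n else 0)"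
    unfolding form_eval_def using y by (intro sum.cong refl) auto
  then show ?thesis by simp
qed

lemma form_eval_mult:
  "\<exists>c. \<forall>p :: 'k::field proj1. form_eval m a p * form_eval n b p = form_eval (m + n) c p"
proof -
  \<comment> \<open>A form of degree \<open>m\<close> ignores the coefficients beyond
    \<open>m\<close>, but the convolution would see them; hence the truncation.\<close>
  define a' where "a' i = (if i \<le> m then a i else 0)" for i
  define b' where "b' i = (if i \<le> n then b i else 0)" for i
  define c where "c r = (\<Sum>k\<le>r. a' k * b' (r - k))" for r
  \<comment> \<open>Dehomogenizing does not reach the point with \<open>yc p = 0\<close>, where a
    form shows only its top coefficient.\<close>
  have top: "c (m + n) = a m * b n"
  proof -
    have "c (m + n) = (\<Sum>k\<le>m + n. if k = m then a m * b n else 0)"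
      unfolding c_def by (intro sum.cong refl) (auto simp: a'_def b'_def)
    then show ?thesis by simp
  qed
  have "form_eval m a p * form_eval n b p = form_eval (m + n) c p" for p :: "'k proj1"
  proof (cases "yc p = 0")
    case True
    then show ?thesis
      by (simp add: form_eval_if_y_zero top power_add)
  next
    case False
    let ?t = "xc p / yc p"
    have "(\<Sum>i\<le>m. a' i * ?t ^ i) * (\<Sum>i\<le>n. b' i * ?t ^ i) = (\<Sum>r\<le>m + n. c r * ?t ^ r)"
      unfolding c_def by (rule polynomial_product) (auto simp: a'_def b'_def)
    then have "(\<Sum>i\<le>m. a i * ?t ^ i) * (\<Sum>i\<le>n. b i * ?t ^ i) = (\<Sum>r\<le>m + n. c r * ?t ^ r)"
      by (simp add: a'_def b'_def)
    then show ?thesis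
      using False by (simp add: form_eval_poly_if_y power_add)
  qed
  then show ?thesis by blast
qed

lemma form_eval_hcoord_power: "\<exists>c. \<forall>p :: 'k::field proj1. form_eval n c p = hcoord b p ^ n"
proof (cases b)
  case True
  have "form_eval n (\<lambda>i. if i = 0 then 1 else 0) p = (\<Sum>i\<le>n. if i = 0 then yc p ^ n else 0)" for p :: "'k proj1"
    unfolding form_eval_def by (intro sum.cong refl) auto
  then show ?thesis
    using True by (intro exI[of _ "\<lambda>i. if i = 0 then 1 else 0"]) (simp add: hcoord_def)
next
  case False
  have "form_eval n (\<lambda>i. if i = n then 1 else 0) p = (\<Sum>i\<le>n. if i = n then xc p ^ n else 0)" for p :: "'k proj1"
    unfolding form_eval_def by (intro sum.cong refl) auto
  then show ?thesis
    using False by (intro exI[of _ "\<lambda>i. if i = n then 1 else 0"]) (simp add: hcoord_def)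
qed

lemma form_eval_affine:
  "\<exists>q :: 'k::field poly. \<forall>t. form_eval n c (affine b t) = hcoord b (affine b t) ^ n * poly q t"
proof (cases b)
  case True
  let ?q = "\<Sum>i\<le>n. monom (c i) i"
  have "form_eval n c (affine b t) = hcoord b (affine b t) ^ n * poly ?q t" for t
  proof -
    obtain l where "l \<noteq> 0" "hcoord b (affine b t) = l" "hcoord (\<not> b) (affine b t) = l * t"
      using affine_coords .
    moreover have "l ^ i * l ^ (n - i) = l ^ n" if "i \<le> n" for i
      using that by (simp flip: power_add)
    ultimately show ?thesis
      using True unfolding form_eval_def poly_sum poly_monom sum_distrib_left hcoord_def
      by (intro sum.cong refl) (simp add: power_mult_distrib mult_ac)
  qed
  then show ?thesis by blast
next
  case False
  \<comment> \<open>In this chart the affine coordinate is y/x, so the exponents are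
    reversed.\<close>
  let ?q = "\<Sum>i\<le>n. monom (c i) (n - i)"
  have "form_eval n c (affine b t) = hcoord b (affine b t) ^ n * poly ?q t" for t
  proof -
    obtain l where l: "l \<noteq> 0" "hcoord b (affine b t) = l" "hcoord (\<not> b) (affine b t) = l * t"
      using affine_coords .
    have pw: "l ^ i * l ^ (n - i) = l ^ n" if "i \<le> n" for i
      using that by (simp flip: power_add)
    have "c i * l ^ i * (l * t) ^ (n - i) = l ^ n * (c i * t ^ (n - i))" if "i \<le> n" for i
      using that by (simp add: power_mult_distrib mult_ac flip: pw)
    then show ?thesis
      using False l unfolding form_eval_def poly_sum poly_monom sum_distrib_left hcoord_def
      by (intro sum.cong refl) simp
  qed
  then show ?thesis by blast
qed

text \<open>The form is the determinant of the homogeneous coordinates of \<open>p\<close> and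
  \<open>q\<close>.\<close>

lemma linear_form_zero: "\<exists>c. \<forall>q. form_eval 1 c q = 0 \<longleftrightarrow> q = (p :: 'k::field proj1)"
proof -
  have "form_eval 1 (\<lambda>i. if i = 0 then - xc p else yc p) q = yc p * xc q - xc p * yc q" for q
    by (simp add: form_eval_def)
  then show ?thesis
    by (intro exI[of _ "\<lambda>i. if i = 0 then - xc p else yc p"])
      (auto simp: proj1_eq_iff[of q p for q] mult.commute)
qed

text \<open>A product of linear forms, one for each point of \<open>Z\<close>, filled up to degree
  \<open>n\<close> by factors that do not vanish at \<open>p\<close>.\<close>

lemma separating_form:
  assumes "finite Z" "p \<notin> Z" "card Z \<le> n"
  shows "\<exists>c. form_eval n c (p :: 'k::field proj1) \<noteq> 0 \<and> (\<forall>z\<in>Z. form_eval n c z = 0)"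
  using assms
proof (induction n arbitrary: Z)
  case 0
  then show ?case
    by (intro exI[of _ "\<lambda>_. 1"]) (simp add: form_eval_def)
next
  case (Suc n)
  \<comment> \<open>Once \<open>Z\<close> is exhausted, the spare factor is given a zero at any
    point other than \<open>p\<close>.\<close>
  obtain z Z' where z: "z \<noteq> p" "Z \<subseteq> insert z Z'" "finite Z'" "p \<notin> Z'" "card Z' \<le> n"
  proof (cases "Z = {}")
    case True
    have "\<exists>z. z \<noteq> p"
      using pt_zero_neq_pt_infty by metis
    then show ?thesis
      using that[of _ "{}"] True by auto
  next
    case False
    then obtain z where "z \<in> Z" by blast
    moreover have "z \<noteq> p" "card (Z - {z}) \<le> n"
      using \<open>z \<in> Z\<close> Suc.prems by auto
    ultimately show ?thesis
      using that[of z "Z - {z}"] Suc.prems by simp blast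
  qed
  obtain c where c: "form_eval n c p \<noteq> 0" "\<forall>z\<in>Z'. form_eval n c z = 0"
    using Suc.IH[OF z(3-5)] by blast
  obtain l where l: "\<And>q. form_eval 1 l q = 0 \<longleftrightarrow> q = z"
    using linear_form_zero[of z] by blast
  obtain m where "\<And>q :: 'k proj1. form_eval n c q * form_eval 1 l q = form_eval (n + 1) m q"
    using form_eval_mult by metis
  then have m: "form_eval (Suc n) m q = form_eval n c q * form_eval 1 l q" for q
    by simp
  show ?case
    using c l z(1,2) by (intro exI[of _ m]) (auto simp: m)
qed

subsection \<open>The structure sheaf\<close>

lemma openin_P1_form: "openin (zariski P1) {p. form_eval n c p \<noteq> 0}"
  unfolding P1_def Let_def fun_space.simps by (rule topology_generated_by_Basis) blast

lemma openin_P1_hcoord: "openin (zariski P1) {p. hcoord b p \<noteq> 0}"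
proof -
  obtain c where "\<And>p :: 'a proj1. form_eval 1 c p = hcoord b p ^ 1"
    using form_eval_hcoord_power by metis
  then show ?thesis
    using openin_P1_form[of 1 c] by simp
qed

lemma openin_P1_UNIV: "openin (zariski P1) (UNIV :: 'k::field proj1 set)"
proof -
  have "(\<Union>b. {p. hcoord b p \<noteq> 0}) = (UNIV :: 'k proj1 set)"
    using hcoord_some_nonzero by auto
  moreover have "openin (zariski P1) (\<Union>b. {p :: 'k proj1. hcoord b p \<noteq> 0})"
    using openin_P1_hcoord by blast
  ultimately show ?thesis by metis
qed

lemma points_P1: "points P1 = (UNIV :: 'k::field proj1 set)"
  using openin_P1_UNIV openin_subset by blast

section \<open>Locality and closure properties of regular functions\<close>

lemma regular_P1_iff:
  "regular P1 U f \<longleftrightarrow> (\<forall>p\<in>U. \<exists>V. openin (zariski P1) V \<and> p \<in> V \<and> V \<subseteq> U \<and>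
     (\<exists>n a b. \<forall>q\<in>V. form_eval n b q \<noteq> 0 \<and> f q = form_eval n a q / form_eval n b q))"
  by (simp add: P1_def Let_def)

lemma regular_P1E:
  assumes "regular P1 U f" "p \<in> U"
  obtains V n b a where "openin (zariski P1) V" "p \<in> V" "V \<subseteq> U"
    "\<forall>q\<in>V. form_eval n b q \<noteq> 0 \<and> f q = form_eval n a q / form_eval n b q"
proof -
  have "\<exists>V. openin (zariski P1) V \<and> p \<in> V \<and> V \<subseteq> U \<and>
     (\<exists>n a b. \<forall>q\<in>V. form_eval n b q \<noteq> 0 \<and> f q = form_eval n a q / form_eval n b q)"
    using assms(1) unfolding regular_P1_iff by (rule bspec) (rule assms(2))
  then show ?thesis
    using that by (elim exE conjE) blast
qed

lemma regular_P1_cong: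
  assumes f: "regular P1 U f" and eq: "\<And>p. p \<in> U \<Longrightarrow> f p = g p"
  shows "regular P1 U g"
  unfolding regular_P1_iff
proof
  fix p assume p: "p \<in> U"
  obtain V n a b where V: "openin (zariski P1) V" "p \<in> V" "V \<subseteq> U"
    "\<forall>q\<in>V. form_eval n b q \<noteq> 0 \<and> f q = form_eval n a q / form_eval n b q"
    by (rule regular_P1E[OF f p])
  then have "form_eval n b q \<noteq> 0 \<and> g q = form_eval n a q / form_eval n b q" if "q \<in> V" for q
    using that eq[of q] by (metis subsetD)
  then show "\<exists>V. openin (zariski P1) V \<and> p \<in> V \<and> V \<subseteq> U \<and>
     (\<exists>n a b. \<forall>q\<in>V. form_eval n b q \<noteq> 0 \<and> g q = form_eval n a q / form_eval n b q)"
    using V(1-3) by blast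
qed

lemma regular_P1_subset:
  assumes "regular P1 U f" "openin (zariski P1) V" "V \<subseteq> U"
  shows "regular P1 V f"
  unfolding regular_P1_iff
proof
  fix p assume p: "p \<in> V"
  then have "p \<in> U"
    using assms(3) by blast
  obtain W n a b where W: "openin (zariski P1) W" "p \<in> W"
    and f: "\<forall>q\<in>W. form_eval n b q \<noteq> 0 \<and> f q = form_eval n a q / form_eval n b q"
    by (rule regular_P1E[OF assms(1) \<open>p \<in> U\<close>])
  then show "\<exists>W. openin (zariski P1) W \<and> p \<in> W \<and> W \<subseteq> V \<and>
     (\<exists>n a b. \<forall>q\<in>W. form_eval n b q \<noteq> 0 \<and> f q = form_eval n a q / form_eval n b q)"
    using p assms(2) by (intro exI[of _ "W \<inter> V"]) blast
qed

lemma regular_P1_local: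
  assumes "\<And>p. p \<in> U \<Longrightarrow> \<exists>V. p \<in> V \<and> V \<subseteq> U \<and> regular P1 V f"
  shows "regular P1 U f"
  unfolding regular_P1_iff
proof
  fix p assume "p \<in> U"
  then obtain V where V: "p \<in> V" "V \<subseteq> U" "regular P1 V f"
    using assms by blast
  obtain W n a b where "openin (zariski P1) W" "p \<in> W" "W \<subseteq> V"
    "\<forall>q\<in>W. form_eval n b q \<noteq> 0 \<and> f q = form_eval n a q / form_eval n b q"
    by (rule regular_P1E[OF V(3,1)])
  then show "\<exists>V. openin (zariski P1) V \<and> p \<in> V \<and> V \<subseteq> U \<and>
     (\<exists>n a b. \<forall>q\<in>V. form_eval n b q \<noteq> 0 \<and> f q = form_eval n a q / form_eval n b q)"
    using V(2) by (intro exI[of _ W]) blast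
qed

text \<open>Cross-multiplication keeps both forms in degree \<open>n + m\<close>, and the
  nonvanishing of \<open>g\<close> makes the new denominator nonzero.\<close>

lemma regular_P1_divide:
  assumes f: "regular P1 U f" and g: "regular P1 U g" and nz: "\<And>p. p \<in> U \<Longrightarrow> g p \<noteq> 0"
  shows "regular P1 U (\<lambda>p :: 'k::field proj1. f p / g p)"
  unfolding regular_P1_iff
proof
  fix p assume p: "p \<in> U"
  obtain V n a b where V: "openin (zariski P1) V" "p \<in> V" "V \<subseteq> U"
    "\<forall>q\<in>V. form_eval n b q \<noteq> 0 \<and> f q = form_eval n a q / form_eval n b q"
    by (rule regular_P1E[OF f p])
  obtain W m c d where W: "openin (zariski P1) W" "p \<in> W" "W \<subseteq> U"
    "\<forall>q\<in>W. form_eval m d q \<noteq> 0 \<and> g q = form_eval m c q / form_eval m d q"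
    by (rule regular_P1E[OF g p])
  obtain x where x: "\<And>q :: 'k proj1. form_eval n a q * form_eval m d q = form_eval (n + m) x q"
    using form_eval_mult by metis
  obtain y where y: "\<And>q :: 'k proj1. form_eval n b q * form_eval m c q = form_eval (n + m) y q"
    using form_eval_mult by metis
  have "form_eval (n + m) y q \<noteq> 0 \<and> f q / g q = form_eval (n + m) x q / form_eval (n + m) y q"
    if q: "q \<in> V \<inter> W" for q
    using V(3) V(4)[rule_format, of q] W(4)[rule_format, of q] nz[of q] q by (auto simp flip: x y)
  then show "\<exists>V. openin (zariski P1) V \<and> p \<in> V \<and> V \<subseteq> U \<and> (\<exists>n a b. \<forall>q\<in>V.
      form_eval n b q \<noteq> 0 \<and> f q / g q = form_eval n a q / form_eval n b q)"
    using V(1-3) W(1,2) by (intro exI[of _ "V \<inter> W"]) blast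
qed

lemma regular_P1_mult:
  assumes f: "regular P1 U f" and g: "regular P1 U g"
  shows "regular P1 U (\<lambda>p :: 'k::field proj1. f p * g p)"
  unfolding regular_P1_iff
proof
  fix p assume p: "p \<in> U"
  obtain V n a b where V: "openin (zariski P1) V" "p \<in> V" "V \<subseteq> U"
    "\<forall>q\<in>V. form_eval n b q \<noteq> 0 \<and> f q = form_eval n a q / form_eval n b q"
    by (rule regular_P1E[OF f p])
  obtain W m c d where W: "openin (zariski P1) W" "p \<in> W" "W \<subseteq> U"
    "\<forall>q\<in>W. form_eval m d q \<noteq> 0 \<and> g q = form_eval m c q / form_eval m d q"
    by (rule regular_P1E[OF g p])
  obtain x where x: "\<And>q :: 'k proj1. form_eval n a q * form_eval m c q = form_eval (n + m) x q"
    using form_eval_mult by metis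
  obtain y where y: "\<And>q :: 'k proj1. form_eval n b q * form_eval m d q = form_eval (n + m) y q"
    using form_eval_mult by metis
  have "form_eval (n + m) y q \<noteq> 0 \<and> f q * g q = form_eval (n + m) x q / form_eval (n + m) y q"
    if q: "q \<in> V \<inter> W" for q
    using V(4)[rule_format, of q] W(4)[rule_format, of q] q by (auto simp flip: x y)
  then show "\<exists>V. openin (zariski P1) V \<and> p \<in> V \<and> V \<subseteq> U \<and> (\<exists>n a b. \<forall>q\<in>V.
      form_eval n b q \<noteq> 0 \<and> f q * g q = form_eval n a q / form_eval n b q)"
    using V(1-3) W(1,2) by (intro exI[of _ "V \<inter> W"]) blast
qed

lemma regular_P1_add:
  assumes f: "regular P1 U f" and g: "regular P1 U g"
  shows "regular P1 U (\<lambda>p :: 'k::field proj1. f p + g p)"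
  unfolding regular_P1_iff
proof
  fix p assume p: "p \<in> U"
  obtain V n a b where V: "openin (zariski P1) V" "p \<in> V" "V \<subseteq> U"
    "\<forall>q\<in>V. form_eval n b q \<noteq> 0 \<and> f q = form_eval n a q / form_eval n b q"
    by (rule regular_P1E[OF f p])
  obtain W m c d where W: "openin (zariski P1) W" "p \<in> W" "W \<subseteq> U"
    "\<forall>q\<in>W. form_eval m d q \<noteq> 0 \<and> g q = form_eval m c q / form_eval m d q"
    by (rule regular_P1E[OF g p])
  obtain x where x: "\<And>q :: 'k proj1. form_eval n a q * form_eval m d q = form_eval (n + m) x q"
    using form_eval_mult by metis
  obtain y where y: "\<And>q :: 'k proj1. form_eval n b q * form_eval m c q = form_eval (n + m) y q"
    using form_eval_mult by metis
  obtain z where z: "\<And>q :: 'k proj1. form_eval n b q * form_eval m d q = form_eval (n + m) z q"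
    using form_eval_mult by metis
  have sum: "form_eval (n + m) (\<lambda>i. x i + y i) q = form_eval (n + m) x q + form_eval (n + m) y q"
    for q :: "'k proj1"
    by (simp add: form_eval_def algebra_simps sum.distrib)
  have "form_eval (n + m) z q \<noteq> 0 \<and>
      f q + g q = form_eval (n + m) (\<lambda>i. x i + y i) q / form_eval (n + m) z q"
    if q: "q \<in> V \<inter> W" for q
    using V(4)[rule_format, of q] W(4)[rule_format, of q] q
    by (auto simp: sum add_frac_eq mult_ac simp flip: x y z)
  then show "\<exists>V. openin (zariski P1) V \<and> p \<in> V \<and> V \<subseteq> U \<and> (\<exists>n a b. \<forall>q\<in>V.
      form_eval n b q \<noteq> 0 \<and> f q + g q = form_eval n a q / form_eval n b q)"
    using V(1-3) W(1,2) by (intro exI[of _ "V \<inter> W"]) blast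
qed

lemma regular_P1_const:
  assumes "openin (zariski P1) U"
  shows "regular P1 U (\<lambda>_ :: 'k::field proj1. c)"
  unfolding regular_P1_iff
proof
  fix p assume "p \<in> U"
  moreover have "form_eval 0 (\<lambda>_. 1) q \<noteq> 0 \<and> c = form_eval 0 (\<lambda>_. c) q / form_eval 0 (\<lambda>_. 1) q"
    for q :: "'k proj1"
    by (simp add: form_eval_def)
  ultimately show "\<exists>V. openin (zariski P1) V \<and> p \<in> V \<and> V \<subseteq> U \<and> (\<exists>n a b. \<forall>q\<in>V.
      form_eval n b q \<noteq> 0 \<and> c = form_eval n a q / form_eval n b q)"
    using assms by blast
qed

lemma finite_affine_complement:
  fixes V :: "'k::field proj1 set"
  assumes "openin (zariski P1) V" "affine b t \<in> V"
  shows "finite {s. affine b s \<notin> V}"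
proof -
  have "generate_topology_on {{p :: 'k proj1. form_eval n c p \<noteq> 0} |n c. True} V"
    using assms(1) unfolding P1_def Let_def by (simp add: openin_topology_generated_by_iff)
  \<comment> \<open>Meeting the chart is the right premise for the induction: it excludes the open
    set of the zero form, and it passes from a union to one of its members.\<close>
  then have "(\<exists>t. affine b t \<in> V) \<longrightarrow> finite {s. affine b s \<notin> V}"
  proof induction
    case (Int U V)
    moreover have "{s. affine b s \<notin> U \<inter> V} = {s. affine b s \<notin> U} \<union> {s. affine b s \<notin> V}"
      by auto
    ultimately show ?case by auto
  next
    case (UN K)
    show ?case
    proof (intro impI)
      assume "\<exists>t. affine b t \<in> \<Union>K"
      then obtain V where V: "V \<in> K" "\<exists>t. affine b t \<in> V" by blast
      then have "finite {s. affine b s \<notin> V}"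
        using UN by blast
      then show "finite {s. affine b s \<notin> \<Union>K}"
        by (rule rev_finite_subset) (use V(1) in auto)
    qed
  next
    case (Basis V)
    then obtain n c where V: "V = {p. form_eval n c p \<noteq> 0}" by blast
    obtain q where q: "\<And>t. form_eval n c (affine b t) = hcoord b (affine b t) ^ n * poly q t"
      using form_eval_affine by metis
    have iff: "affine b t \<in> V \<longleftrightarrow> poly q t \<noteq> 0" for t
      by (simp add: V q affine_hcoord)
    show ?case
    proof
      assume "\<exists>t. affine b t \<in> V"
      then have "q \<noteq> 0"
        using iff by auto
      then show "finite {s. affine b s \<notin> V}"
        by (simp add: iff poly_roots_finite)
    qed
  qed simp
  then show ?thesis
    using assms(2) by blast
qed

text \<open>In a quotient of forms of equal degree the powers of \<open>hcoord b\<close> contributed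
  by the chosen representatives cancel. What remains is a quotient of polynomials in the affine
  coordinate, valid on a cofinite set.\<close>

lemma regular_on_affine_imp_polynomial:
  fixes f :: "'k::alg_closed_field proj1 \<Rightarrow> 'k"
  assumes "regular P1 {p. hcoord b p \<noteq> 0} f"
  shows "\<exists>q. \<forall>t. f (affine b t) = poly q t"
proof (rule locally_rational_imp_polynomial)
  fix t :: 'k
  obtain V n c d where V: "openin (zariski P1) V" "affine b t \<in> V"
    and f: "\<forall>q\<in>V. form_eval n d q \<noteq> 0 \<and> f q = form_eval n c q / form_eval n d q"
    using assms by (rule regular_P1E[of _ _ "affine b t"]) (simp add: affine_hcoord)
  obtain x where x: "\<And>t. form_eval n c (affine b t) = hcoord b (affine b t) ^ n * poly x t"
    using form_eval_affine by metis
  obtain y where y: "\<And>t. form_eval n d (affine b t) = hcoord b (affine b t) ^ n * poly y t"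
    using form_eval_affine by metis
  show "\<exists>C a b'. t \<in> C \<and> finite (- C) \<and>
      (\<forall>s\<in>C. poly b' s \<noteq> 0 \<and> f (affine b s) = poly a s / poly b' s)"
  proof (rule exI[of _ "{s. affine b s \<in> V}"], rule exI[of _ x], rule exI[of _ y], intro conjI ballI)
    show "finite (- {s. affine b s \<in> V})"
      using finite_affine_complement[OF V] by (simp add: Collect_neg_eq)
    show "t \<in> {s. affine b s \<in> V}"
      using V by simp
  next
    fix s assume "s \<in> {s. affine b s \<in> V}"
    then have "form_eval n d (affine b s) \<noteq> 0 \<and>
        f (affine b s) = form_eval n c (affine b s) / form_eval n d (affine b s)"
      using f by blast
    then show "poly y s \<noteq> 0" "f (affine b s) = poly x s / poly y s"
      by (auto simp: x y affine_hcoord)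
  qed
qed

subsection \<open>Global sections of twisting sheaves\<close>

text \<open>
  Forms of degree \<open>n - 1\<close>, as functions of the chosen homogeneous coordinates; the shift makes the
  degree \<open>-1\<close> available, where the space is zero.
\<close>

definition forms :: "nat \<Rightarrow> ('k::field proj1 \<Rightarrow> 'k) set" where
  "forms n = {\<lambda>p. \<Sum>i<n. c i * xc p ^ i * yc p ^ (n - 1 - i) |c. True}"

lemma forms_0: "forms 0 = {\<lambda>_. 0}"
  by (simp add: forms_def)

lemma forms_Suc: "forms (Suc n) = {form_eval n c |c. True}"
  by (simp add: forms_def form_eval_def[abs_def] lessThan_Suc_atMost)

lemma forms_add: "f \<in> forms n \<Longrightarrow> g \<in> forms n \<Longrightarrow> f + g \<in> forms n"
proof -
  assume "f \<in> forms n" "g \<in> forms n"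
  then obtain c d where "f = (\<lambda>p. \<Sum>i<n. c i * xc p ^ i * yc p ^ (n - 1 - i))"
    "g = (\<lambda>p. \<Sum>i<n. d i * xc p ^ i * yc p ^ (n - 1 - i))"
    unfolding forms_def by blast
  then show ?thesis
    unfolding forms_def
    by (intro CollectI exI[of _ "\<lambda>i. c i + d i"]) (auto simp: fun_eq_iff sum.distrib algebra_simps)
qed

lemma forms_scale: "f \<in> forms n \<Longrightarrow> (\<lambda>p. a * f p) \<in> forms n"
proof -
  assume "f \<in> forms n"
  then obtain c where "f = (\<lambda>p. \<Sum>i<n. c i * xc p ^ i * yc p ^ (n - 1 - i))"
    unfolding forms_def by blast
  then show ?thesis
    unfolding forms_def
    by (intro CollectI exI[of _ "\<lambda>i. a * c i"]) (auto simp: fun_eq_iff sum_distrib_left mult_ac)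
qed

lemma forms_zero: "(\<lambda>_. 0) \<in> forms n"
  unfolding forms_def by (intro CollectI exI[of _ "\<lambda>_. 0"]) simp

lemma separating_forms:
  assumes "finite Z" "p \<notin> Z" "card Z < n"
  shows "\<exists>f\<in>forms n. f p \<noteq> 0 \<and> (\<forall>z\<in>Z. f z = 0)"
proof -
  obtain m where m: "n = Suc m"
    using assms(3) by (cases n) auto
  then obtain c where "form_eval m c p \<noteq> 0 \<and> (\<forall>z\<in>Z. form_eval m c z = 0)"
    using separating_form[of Z p m] assms by auto
  then show ?thesis
    by (auto simp: m forms_Suc)
qed

text \<open>The dehomogenization has degree below \<open>n\<close> and \<open>n\<close> roots, so it
  is zero. Its coefficients are those of the form, which therefore vanishes also at the point
  outside the chart.\<close>

lemma forms_eq_zero: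
  fixes f :: "'k::field proj1 \<Rightarrow> 'k"
  assumes f: "f \<in> forms n" and T: "finite T" "card T = n" "\<And>t. t \<in> T \<Longrightarrow> f (affine True t) = 0"
  shows "f = (\<lambda>_. 0)"
proof -
  obtain c where c: "f = (\<lambda>p. \<Sum>i<n. c i * xc p ^ i * yc p ^ (n - 1 - i))"
    using f unfolding forms_def by blast
  define q where "q = (\<Sum>i<n. monom (c i) i)"
  have fq: "f (affine True t) = hcoord True (affine True t) ^ (n - 1) * poly q t" for t
  proof -
    obtain l where "l \<noteq> 0" "hcoord True (affine True t) = l" "hcoord (\<not> True) (affine True t) = l * t"
      using affine_coords .
    moreover have "l ^ i * l ^ (n - 1 - i) = l ^ (n - 1)" if "i < n" for i
      using that by (simp flip: power_add)
    ultimately show ?thesis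
      unfolding c q_def poly_sum poly_monom sum_distrib_left hcoord_def
      by (intro sum.cong refl) (simp add: power_mult_distrib mult_ac)
  qed
  have coeff_q: "coeff q i = (if i < n then c i else 0)" for i
    by (simp add: q_def coeff_sum)
  have "q = 0"
  proof (rule ccontr)
    assume nz: "q \<noteq> 0"
    have "T \<subseteq> {t. poly q t = 0}"
      using T(3) by (auto simp: fq affine_hcoord)
    then have "n \<le> card {t. poly q t = 0}"
      using T(2) poly_roots_finite[OF nz] card_mono by blast
    also have "\<dots> \<le> degree q"
      using card_poly_roots_bound[OF nz] .
    finally have "coeff q (degree q) = 0"
      by (simp add: coeff_q)
    then show False
      using nz by simp
  qed
  then have "c i = 0" if "i < n" for i
    using coeff_q[of i] that by simp
  then show ?thesis
    by (simp add: c)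
qed

lemma forms_regular:
  assumes "f \<in> forms n"
  shows "regular P1 {p. hcoord b p \<noteq> 0} (\<lambda>p :: 'k::field proj1. f p / hcoord b p powi (int n - 1))"
proof (cases n)
  \<comment> \<open>In degree -1 the power of \<open>hcoord b\<close> has a negative exponent; as
    \<open>f\<close> is zero, the quotient is represented by constant forms instead.\<close>
  case 0
  obtain c where c: "\<And>p :: 'k proj1. form_eval 0 c p = hcoord b p ^ 0"
    using form_eval_hcoord_power by metis
  have f: "f p = 0" for p
    using assms 0 by (simp add: forms_0)
  show ?thesis
    unfolding regular_P1_iff
  proof (intro ballI exI[of _ "{p. hcoord b p \<noteq> 0}"] conjI, goal_cases)
    case (4 p)
    show ?case
    proof (rule exI[of _ 0], rule exI[of _ "\<lambda>_. 0"], rule exI[of _ c], intro ballI conjI)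
      show "form_eval 0 c q \<noteq> 0" for q :: "'k proj1"
        by (simp add: c)
      show "f q / hcoord b q powi (int n - 1) = form_eval 0 (\<lambda>_. 0) q / form_eval 0 c q" for q
        by (simp add: f form_eval_def)
    qed
  qed (use openin_P1_hcoord in auto)
next
  case (Suc m)
  obtain a where a: "f = form_eval m a"
    using assms Suc by (auto simp: forms_Suc)
  obtain c where c: "\<And>p :: 'k proj1. form_eval m c p = hcoord b p ^ m"
    using form_eval_hcoord_power by metis
  show ?thesis
    unfolding regular_P1_iff
  proof (intro ballI exI[of _ "{p. hcoord b p \<noteq> 0}"] conjI, goal_cases)
    case (4 p)
    show ?case
    proof (rule exI[of _ m], rule exI[of _ a], rule exI[of _ c], intro ballI conjI)
      fix q :: "'k proj1" assume "q \<in> {p. hcoord b p \<noteq> 0}"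
      then show "form_eval m c q \<noteq> 0"
        "f q / hcoord b q powi (int n - 1) = form_eval m a q / form_eval m c q"
        using Suc by (simp_all add: a c power_int_def)
    qed
  qed (use openin_P1_hcoord in auto)
qed

text \<open>The expressions of \<open>f\<close> in the two charts are polynomials P in x/y and Q in
  y/x. On the overlap P(t) is t to the power \<open>n - 1\<close> times Q(1/t), which bounds the
  degree of P.\<close>

lemma regular_imp_forms:
  fixes f :: "'k::alg_closed_field proj1 \<Rightarrow> 'k"
  assumes reg: "\<And>b. regular P1 {p. hcoord b p \<noteq> 0} (\<lambda>p. f p / hcoord b p powi (int n - 1))"
  shows "f \<in> forms n"
proof -
  have "\<exists>q. \<forall>t. f (affine b t) / hcoord b (affine b t) powi (int n - 1) = poly q t" for b
    using regular_on_affine_imp_polynomial[OF reg[of b]] .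
  then obtain q where q: "\<And>b t. f (affine b t) / hcoord b (affine b t) powi (int n - 1) = poly (q b) t"
    by metis
  have fq: "f (affine b t) = poly (q b) t * hcoord b (affine b t) powi (int n - 1)" for b t
    using q[of b t, symmetric] by (simp add: affine_hcoord)
  let ?P = "q True" and ?Q = "q False"
  define m where "m = degree ?Q"
  \<comment> \<open>The factor \<open>t ^ Suc m\<close> clears the denominator of Q(1/t), producing
    the reflected polynomial, and also the exponent -1 that occurs for \<open>n = 0\<close>.\<close>
  have overlap: "poly ?P t * t ^ Suc m = t ^ n * poly (reflect_poly ?Q) t" if t: "t \<noteq> 0" for t
  proof -
    obtain l where l: "l \<noteq> 0" "hcoord True (affine True t) = l" "hcoord (\<not> True) (affine True t) = l * t"
      using affine_coords .
    have "poly ?P t * l powi (int n - 1) = poly ?Q (inverse t) * (l * t) powi (int n - 1)"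
      using fq[of True t] fq[of False "inverse t"] affine_swap[OF t, of True] l by simp
    then have "poly ?P t = poly ?Q (inverse t) * t powi (int n - 1)"
      using l(1) by (simp add: power_int_mult_distrib)
    also have "t powi (int n - 1) = t ^ n / t"
      using t by (simp add: power_int_diff)
    finally show ?thesis
      using t by (simp add: poly_reflect_poly_nz m_def field_simps)
  qed
  have "{t. poly (?P * monom 1 (Suc m)) t \<noteq> poly (monom 1 n * reflect_poly ?Q) t} \<subseteq> {0}"
    using overlap by (auto simp: poly_monom)
  then have eq: "?P * monom 1 (Suc m) = monom 1 n * reflect_poly ?Q"
    by (intro poly_eq_if_cofinite_eq) (meson finite.emptyI finite_insert finite_subset)
  \<comment> \<open>Compare degrees in \<open>eq\<close>: the reflected polynomial has degree at
    most \<open>m\<close>.\<close>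
  have deg: "coeff ?P i = 0" if "i \<ge> n" for i
  proof (cases "?P = 0")
    case False
    then have nz: "reflect_poly ?Q \<noteq> 0"
      using eq by (metis monom_eq_0_iff mult_eq_0_iff one_neq_zero)
    have "degree ?P + Suc m = degree (?P * monom 1 (Suc m))"
      using False by (simp add: degree_mult_eq degree_monom_eq monom_eq_0_iff)
    also have "\<dots> = n + degree (reflect_poly ?Q)"
      unfolding eq using nz by (simp add: degree_mult_eq degree_monom_eq monom_eq_0_iff)
    also have "\<dots> \<le> n + m"
      using degree_reflect_poly_le[of ?Q] by (simp add: m_def)
    finally show ?thesis
      using that by (intro coeff_eq_0) simp
  qed simp
  have P: "poly ?P t = (\<Sum>i<n. coeff ?P i * t ^ i)" for t
  proof -
    \<comment> \<open>Padding the sum with zero coefficients up to \<open>degree ?P + n\<close>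
      allows it to be cut at \<open>n\<close> whichever of the two numbers is larger.\<close>
    have "poly ?P t = (\<Sum>i\<le>degree ?P + n. coeff ?P i * t ^ i)"
      unfolding poly_altdef by (rule sum.mono_neutral_left) (auto simp: coeff_eq_0)
    also have "\<dots> = (\<Sum>i<n. coeff ?P i * t ^ i)"
      by (rule sum.mono_neutral_right) (use deg in auto)
    finally show ?thesis .
  qed
  have "f p = (\<Sum>i<n. coeff ?P i * xc p ^ i * yc p ^ (n - 1 - i))" for p
  proof (cases "yc p = 0")
    case False
    define t where "t = xc p / yc p"
    have p: "affine True t = p"
      using affine_of_ratio[of True p] False by (simp add: t_def hcoord_def)
    have "f p = (\<Sum>i<n. coeff ?P i * t ^ i * yc p powi (int n - 1))"
      using fq[of True t] by (simp add: p P sum_distrib_right hcoord_def)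
    also have "\<dots> = (\<Sum>i<n. coeff ?P i * xc p ^ i * yc p ^ (n - 1 - i))"
    proof (intro sum.cong refl)
      fix i assume i: "i \<in> {..<n}"
      then have "yc p powi (int n - 1) = yc p ^ i * yc p ^ (n - 1 - i)"
        by (simp add: power_int_def nat_diff_distrib flip: power_add)
      then show "coeff ?P i * t ^ i * yc p powi (int n - 1) = coeff ?P i * xc p ^ i * yc p ^ (n - 1 - i)"
        using False by (simp add: t_def power_divide)
    qed
    finally show ?thesis .
  next
    case True
    then have x: "xc p \<noteq> 0"
      using coords_nonzero by blast
    have p: "affine False 0 = p"
      using affine_of_ratio[of False p] x True by (simp add: hcoord_def)
    have fp: "f p = poly ?Q 0 * xc p powi (int n - 1)"
      using fq[of False 0] by (simp add: p hcoord_def)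
    \<comment> \<open>At the point with \<open>yc p = 0\<close> only Q is available. The coefficient
      at \<open>m + n\<close> in \<open>eq\<close> identifies its value at 0 with the coefficient of
      P at \<open>n - 1\<close>, or with zero if \<open>n = 0\<close>.\<close>
    have Q: "poly ?Q 0 = coeff (monom 1 n * reflect_poly ?Q) (m + n)"
      by (simp add: coeff_monom_mult coeff_reflect_poly m_def poly_0_coeff_0)
    show ?thesis
    proof (cases n)
      case 0
      then have "?P = 0"
        using deg by (intro poly_eqI) simp
      then have "poly ?Q 0 = 0"
        unfolding Q by (simp flip: eq)
      then show ?thesis
        using fp 0 by simp
    next
      case (Suc k)
      have "coeff (?P * monom 1 (Suc m)) (m + n) = coeff ?P k"
        by (subst mult.commute) (simp add: coeff_monom_mult Suc)
      then have "poly ?Q 0 = coeff ?P k"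
        unfolding Q eq .
      then have "f p = coeff ?P k * xc p ^ k"
        using fp Suc by simp
      also have "\<dots> = (\<Sum>i<n. if i = k then coeff ?P k * xc p ^ k else 0)"
        by (simp add: Suc)
      also have "\<dots> = (\<Sum>i<n. coeff ?P i * xc p ^ i * yc p ^ (n - 1 - i))"
        using True Suc by (intro sum.cong refl) auto
      finally show ?thesis .
    qed
  qed
  then show ?thesis
    unfolding forms_def by blast
qed

section \<open>Sections on curves glued from projective lines\<close>

global_interpretation fs: dimension_count scale_sec
  by (intro dimension_count.intro vector_space_scale_sec)

section \<open>Points, regular functions and charts on a glued curve\<close>

lemma openin_glue: "openin (zariski (glue J R)) U \<longleftrightarrow> glue_open J R U"
  by (simp add: glue_def istopology_glue_open topology_inverse')

lemma points_glue: "points (glue J R) = glue_class R ` (J \<times> UNIV)"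
proof -
  have "comp_map R j -` (glue_class R ` (J \<times> UNIV)) = UNIV" if "j \<in> J" for j
    using that by (auto simp: comp_map_def)
  then have "glue_open J R (glue_class R ` (J \<times> UNIV))"
    unfolding glue_open_def by (simp add: openin_P1_UNIV)
  then have "glue_class R ` (J \<times> UNIV) \<subseteq> points (glue J R)"
    by (simp add: openin_glue openin_subset)
  moreover have "points (glue J R) \<subseteq> glue_class R ` (J \<times> UNIV)"
    using openin_topspace[of "zariski (glue J R)"] unfolding openin_glue glue_open_def by blast
  ultimately show ?thesis by blast
qed

lemma comp_map_in_points: "j \<in> J \<Longrightarrow> comp_map R j p \<in> points (glue J R)"
  by (auto simp: points_glue comp_map_def)

lemma regular_glue_iff:
  "regular (glue J R) U f \<longleftrightarrow> (\<forall>j\<in>J. regular P1 (comp_map R j -` U) (\<lambda>p. f (comp_map R j p)))"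
  by (simp add: glue_def)

lemma line_bundle_transition_self:
  assumes "line_bundle X L" "x \<in> cover L i"
  shows "transition L i i x = 1"
proof -
  have "transition L i i x * transition L i i x = transition L i i x" "transition L i i x \<noteq> 0"
    using assms unfolding line_bundle_def by blast+
  then show ?thesis by simp
qed

lemma openin_cover_preimage:
  assumes "line_bundle (glue J R) L" "j \<in> J"
  shows "openin (zariski P1) (comp_map R j -` cover L i)"
  using assms by (auto simp: line_bundle_def openin_glue glue_open_def)

lemma cover_exists:
  assumes "line_bundle (glue J R) L" "j \<in> J"
  shows "\<exists>i. comp_map R j p \<in> cover L i"
  using assms comp_map_in_points[of j J R p] unfolding line_bundle_def by blast

text \<open>
  Over a component the bundle is \<open>\<O>(n - 1)\<close>. Multiplying by \<open>\<alpha>\<close> turns the local expressions of a section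
  into the values of one form of degree \<open>n - 1\<close> at the chosen homogeneous coordinates.
\<close>

definition trivializes ::
  "('j \<times> 'k::field proj1) set set \<Rightarrow> ('i, ('j \<times> 'k proj1) set, 'k) lbundle \<Rightarrow> 'j \<Rightarrow> nat
    \<Rightarrow> ('i \<Rightarrow> 'k proj1 \<Rightarrow> 'k) \<Rightarrow> bool" where
  "trivializes R L j n \<alpha> \<longleftrightarrow>
     (\<forall>i p. comp_map R j p \<in> cover L i \<longrightarrow> \<alpha> i p \<noteq> 0) \<and>
     (\<forall>i i' p. comp_map R j p \<in> cover L i \<inter> cover L i' \<longrightarrow>
        \<alpha> i p * transition L i i' (comp_map R j p) = \<alpha> i' p) \<and>
     (\<forall>i b. regular P1 (comp_map R j -` cover L i \<inter> {p. hcoord b p \<noteq> 0})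
        (\<lambda>p. \<alpha> i p / hcoord b p powi (int n - 1)))"

text \<open>The isomorphism \<open>a i b\<close> depends on the chart \<open>b\<close> of the
  twisting sheaf through a power of \<open>hcoord b\<close>; multiplying by the inverse power
  removes this dependence, so the chart \<open>\<beta> p\<close> chosen at each point is
  immaterial.\<close>

lemma has_degree_imp_trivializes:
  assumes L: "line_bundle (glue J R) L" and j: "j \<in> J" and deg: "has_degree R L j (int n - 1)"
  shows "\<exists>\<alpha>. trivializes R L j n \<alpha>"
proof -
  let ?f = "comp_map R j" and ?N = "int n - 1"
  obtain a where reg: "\<And>i b. regular P1 ({p. ?f p \<in> cover L i} \<inter> {p. hcoord b p \<noteq> 0}) (a i b)"
    and nz: "\<And>i b p. ?f p \<in> cover L i \<Longrightarrow> hcoord b p \<noteq> 0 \<Longrightarrow> a i b p \<noteq> 0"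
    and tr: "\<And>i i' b b' p. ?f p \<in> cover L i \<Longrightarrow> ?f p \<in> cover L i' \<Longrightarrow>
      hcoord b p \<noteq> 0 \<Longrightarrow> hcoord b' p \<noteq> 0 \<Longrightarrow>
      a i b p * transition L i i' (?f p) = (hcoord b' p / hcoord b p) powi ?N * a i' b' p"
    using deg unfolding has_degree_def lb_iso_def pullback_def O_twist_def
    by (simp add: points_P1) blast
  obtain \<beta> where \<beta>: "\<And>p :: 'b proj1. hcoord (\<beta> p) p \<noteq> 0"
    using hcoord_some_nonzero by metis
  define \<alpha> where "\<alpha> i p = a i (\<beta> p) p * hcoord (\<beta> p) p powi ?N" for i p
  have \<alpha>: "\<alpha> i p = a i b p * hcoord b p powi ?N" if "?f p \<in> cover L i" "hcoord b p \<noteq> 0" for i b p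
    using tr[OF that(1,1) that(2) \<beta>] line_bundle_transition_self[OF L that(1)] that(2)
    by (simp add: \<alpha>_def power_int_divide_distrib)
  have "\<alpha> i p * transition L i i' (?f p) = \<alpha> i' p" if "?f p \<in> cover L i" "?f p \<in> cover L i'" for i i' p
    using tr[OF that \<beta> \<beta>] \<beta>[of p] by (simp add: \<alpha>_def mult_ac)
  moreover have "regular P1 (?f -` cover L i \<inter> {p. hcoord b p \<noteq> 0}) (\<lambda>p. \<alpha> i p / hcoord b p powi ?N)" for i b
    by (rule regular_P1_cong[of _ "a i b"]) (use reg[of i b] in \<open>auto simp: \<alpha> vimage_def\<close>)
  moreover have "\<alpha> i p \<noteq> 0" if "?f p \<in> cover L i" for i p
    using nz[OF that \<beta>] \<beta> by (simp add: \<alpha>_def)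
  ultimately show ?thesis
    unfolding trivializes_def by blast
qed

text \<open>On the intersection of a chart of \<open>L\<close> with a coordinate chart, \<alpha>
  divided by the power of \<open>hcoord b\<close> is regular and nowhere zero. Hence
  \<open>s i\<close> and the local expression of \<open>F\<close> are regular together, and
  regularity is local.\<close>

lemma regular_components_iff_form:
  fixes F :: "'k::alg_closed_field proj1 \<Rightarrow> 'k"
  assumes L: "line_bundle (glue J R) L" and j: "j \<in> J" and \<alpha>: "trivializes R L j n \<alpha>"
    and F: "\<And>i p. comp_map R j p \<in> cover L i \<Longrightarrow> F p = \<alpha> i p * s i (comp_map R j p)"
  shows "(\<forall>i. regular P1 (comp_map R j -` cover L i) (\<lambda>p. s i (comp_map R j p))) \<longleftrightarrow> F \<in> forms n"
proof
  let ?f = "comp_map R j" and ?N = "int n - 1"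
  have nz: "\<alpha> i p \<noteq> 0" if "?f p \<in> cover L i" for i p
    using \<alpha> that unfolding trivializes_def by blast
  have reg: "regular P1 (?f -` cover L i \<inter> {p. hcoord b p \<noteq> 0}) (\<lambda>p. \<alpha> i p / hcoord b p powi ?N)" for i b
    using \<alpha> unfolding trivializes_def by blast
  have op: "openin (zariski P1) (?f -` cover L i \<inter> {p. hcoord b p \<noteq> 0})" for i b
    using openin_cover_preimage[OF L j] openin_P1_hcoord by blast
  {
    assume s: "\<forall>i. regular P1 (?f -` cover L i) (\<lambda>p. s i (?f p))"
    show "F \<in> forms n"
    proof (rule regular_imp_forms, rule regular_P1_local)
      fix b and p :: "'k proj1" assume p: "p \<in> {p. hcoord b p \<noteq> 0}"
      obtain i where i: "?f p \<in> cover L i"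
        using cover_exists[OF L j] by blast
      let ?V = "?f -` cover L i \<inter> {p. hcoord b p \<noteq> 0}"
      have "regular P1 ?V (\<lambda>p. \<alpha> i p / hcoord b p powi ?N * s i (?f p))"
        using reg regular_P1_subset[OF s[rule_format] op] by (rule regular_P1_mult) auto
      then have "regular P1 ?V (\<lambda>p. F p / hcoord b p powi ?N)"
        by (rule regular_P1_cong) (auto simp: F)
      then show "\<exists>V. p \<in> V \<and> V \<subseteq> {p. hcoord b p \<noteq> 0} \<and> regular P1 V (\<lambda>p. F p / hcoord b p powi ?N)"
        using p i by (intro exI[of _ ?V]) auto
    qed
  next
    assume "F \<in> forms n"
    then have Freg: "regular P1 {p. hcoord b p \<noteq> 0} (\<lambda>p. F p / hcoord b p powi ?N)" for b
      by (rule forms_regular)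
    show "\<forall>i. regular P1 (?f -` cover L i) (\<lambda>p. s i (?f p))"
    proof (intro allI regular_P1_local)
      fix i p assume p: "p \<in> ?f -` cover L i"
      obtain b where b: "hcoord b p \<noteq> 0"
        using hcoord_some_nonzero by blast
      let ?V = "?f -` cover L i \<inter> {p. hcoord b p \<noteq> 0}"
      have "regular P1 ?V (\<lambda>p. (F p / hcoord b p powi ?N) / (\<alpha> i p / hcoord b p powi ?N))"
        using regular_P1_subset[OF Freg op] reg by (rule regular_P1_divide) (auto simp: nz)
      then have "regular P1 ?V (\<lambda>p. s i (?f p))"
        by (rule regular_P1_cong) (auto simp: F nz)
      then show "\<exists>V. p \<in> V \<and> V \<subseteq> ?f -` cover L i \<and> regular P1 V (\<lambda>p. s i (?f p))"
        using p b by (intro exI[of _ ?V]) auto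
    qed
  }
qed

text \<open>Entries outside \<open>J\<close> are fixed at zero, so that a family is determined by
  its components in \<open>J\<close> and the dimension counts these alone.\<close>

definition families :: "'j set \<Rightarrow> ('j \<Rightarrow> nat) \<Rightarrow> ('j \<Rightarrow> 'k::field proj1 \<Rightarrow> 'k) set" where
  "families J n = {F. (\<forall>j\<in>J. F j \<in> forms (n j)) \<and> (\<forall>j. j \<notin> J \<longrightarrow> F j = (\<lambda>_. 0))}"

lemma subspace_families: "fs.subspace (families J n)"
  unfolding fs.subspace_def
proof (intro conjI ballI allI)
  show "0 \<in> families J n"
    by (simp add: families_def zero_fun_def forms_zero)
  show "F + G \<in> families J n" if "F \<in> families J n" "G \<in> families J n" for F G
  proof -
    have "(F + G) j \<in> forms (n j)" if "j \<in> J" for j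
      using forms_add[of "F j" "n j" "G j"] that \<open>F \<in> _\<close> \<open>G \<in> _\<close> by (simp add: families_def)
    then show ?thesis
      using that by (simp add: families_def fun_eq_iff)
  qed
  show "scale_sec c F \<in> families J n" if "F \<in> families J n" for c F
    using that forms_scale[of "F j" "n j" c for j] by (simp add: families_def scale_sec_def)
qed

lemma subspace_sections:
  assumes L: "line_bundle (glue J R) L"
  shows "fs.subspace (sections (glue J R) L)"
proof -
  have op: "openin (zariski P1) (comp_map R j -` cover L i)" if "j \<in> J" for i j
    using openin_cover_preimage[OF L that] .
  show ?thesis
    unfolding fs.subspace_def
  proof (intro conjI ballI allI)
    show "0 \<in> sections (glue J R) L"
      using op by (simp add: sections_def regular_glue_iff regular_P1_const)
  next
    fix s t
    assume st: "s \<in> sections (glue J R) L" "t \<in> sections (glue J R) L"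
    have "s i x + t i x = transition L i j x * (s j x + t j x)" if "x \<in> cover L i \<inter> cover L j" for i j x
    proof -
      have "s i x = transition L i j x * s j x" "t i x = transition L i j x * t j x"
        using st that unfolding sections_def by blast+
      then show ?thesis
        by (simp only: distrib_left)
    qed
    moreover have "regular (glue J R) (cover L i) (s i + t i)" for i
      unfolding regular_glue_iff plus_fun_apply
      using st by (intro ballI regular_P1_add) (auto simp: sections_def regular_glue_iff)
    moreover have "s i x + t i x = 0" if "x \<notin> cover L i" for i x
      using st that by (simp add: sections_def)
    ultimately show "s + t \<in> sections (glue J R) L"
      unfolding sections_def mem_Collect_eq plus_fun_apply by blast
  next
    fix c s
    assume s: "s \<in> sections (glue J R) L"
    have "c * s i x = transition L i j x * (c * s j x)" if "x \<in> cover L i \<inter> cover L j" for i j x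
    proof -
      have "s i x = transition L i j x * s j x"
        using s that unfolding sections_def by blast
      then show ?thesis
        by (simp only: mult.left_commute)
    qed
    moreover have "regular (glue J R) (cover L i) (\<lambda>x. c * s i x)" for i
      unfolding regular_glue_iff
      using s op by (intro ballI regular_P1_mult regular_P1_const) (auto simp: sections_def regular_glue_iff)
    moreover have "c * s i x = 0" if "x \<notin> cover L i" for i x
      using s that by (simp add: sections_def)
    ultimately show "scale_sec c s \<in> sections (glue J R) L"
      unfolding sections_def mem_Collect_eq scale_sec_def by blast
  qed
qed

text \<open>\<open>M\<close> lists the identified pairs with an order of the two branches. The
  scalars \<kappa> and \<mu> depend on the chosen trivializations; later arguments rely only on
  their being nonzero.\<close>

lemma has_dim_sections_glue:
  fixes L :: "('i, ('j \<times> 'k::alg_closed_field proj1) set, 'k) lbundle"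
  assumes L: "line_bundle (glue J R) L" and deg: "\<And>j. j \<in> J \<Longrightarrow> has_degree R L j (int (n j) - 1)"
    and M: "M \<subseteq> (J \<times> UNIV) \<times> (J \<times> UNIV)"
    and glue: "\<And>u v. u \<in> J \<times> UNIV \<Longrightarrow> v \<in> J \<times> UNIV \<Longrightarrow>
      glue_class R u = glue_class R v \<longleftrightarrow> u = v \<or> (u, v) \<in> M \<or> (v, u) \<in> M"
  obtains \<kappa> \<mu> :: "('j \<times> 'k proj1) \<times> ('j \<times> 'k proj1) \<Rightarrow> 'k"
  where "\<And>m. m \<in> M \<Longrightarrow> \<kappa> m \<noteq> 0" "\<And>m. m \<in> M \<Longrightarrow> \<mu> m \<noteq> 0"
    "\<And>d. fs.has_dim {F \<in> families J n. \<forall>m\<in>M.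
        \<kappa> m * case_prod F (fst m) - \<mu> m * case_prod F (snd m) = 0} d \<Longrightarrow>
      fs.has_dim (sections (glue J R) L) d"
proof -
  have "\<forall>j\<in>J. \<exists>\<alpha>. trivializes R L j (n j) \<alpha>"
    using has_degree_imp_trivializes[OF L _ deg] by blast
  then obtain \<alpha> where \<alpha>: "\<And>j. j \<in> J \<Longrightarrow> trivializes R L j (n j) (\<alpha> j)"
    by metis
  have nz: "\<alpha> j i p \<noteq> 0" if "j \<in> J" "comp_map R j p \<in> cover L i" for i j p
    using \<alpha>[OF that(1)] that(2) unfolding trivializes_def by blast
  have tr: "\<alpha> j i p * transition L i i' (comp_map R j p) = \<alpha> j i' p"
    if "j \<in> J" "comp_map R j p \<in> cover L i" "comp_map R j p \<in> cover L i'" for i i' j p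
    using \<alpha>[OF that(1)] that(2,3) unfolding trivializes_def by blast
  have sub_points: "\<exists>j p. j \<in> J \<and> x = comp_map R j p" if "x \<in> cover L i" for x i
  proof -
    have "x \<in> points (glue J R)"
      using L that unfolding line_bundle_def by blast
    then show ?thesis
      by (auto simp: points_glue comp_map_def)
  qed
  define chart where "chart x = (SOME i. x \<in> cover L i)" for x
  have chart: "comp_map R j p \<in> cover L (chart (comp_map R j p))" if "j \<in> J" for j p
    unfolding chart_def using cover_exists[OF L that] by (rule someI_ex)
  \<comment> \<open>Under a change of chart \<alpha> and the section transform inversely, so the
    product is the same in every chart; this is \<open>\<Phi>_eq\<close>.\<close>
  define \<Phi> where "\<Phi> s = (\<lambda>j p. if j \<in> J
      then \<alpha> j (chart (comp_map R j p)) p * s (chart (comp_map R j p)) (comp_map R j p) else 0)"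
    for s :: "'i \<Rightarrow> ('j \<times> 'k proj1) set \<Rightarrow> 'k"
  \<comment> \<open>The node condition equates \<open>F j p / \<alpha> j i p\<close> with
    \<open>F k q / \<alpha> k i q\<close>, both being the value of the section in a common chart
    \<open>i\<close>. Clearing denominators gives the two coefficients.\<close>
  define \<kappa> where "\<kappa> m = (case m of ((j, p), (k, q)) \<Rightarrow> \<alpha> k (chart (comp_map R j p)) q)" for m
  define \<mu> where "\<mu> m = (case m of ((j, p), (k, q)) \<Rightarrow> \<alpha> j (chart (comp_map R j p)) p)"
    for m :: "('j \<times> 'k proj1) \<times> ('j \<times> 'k proj1)"
  define K where "K = {F \<in> families J n. \<forall>m\<in>M.
      \<kappa> m * case_prod F (fst m) - \<mu> m * case_prod F (snd m) = 0}"
  have same: "comp_map R j p = comp_map R k q" "j \<in> J" "k \<in> J" if "((j, p), (k, q)) \<in> M" for j k p q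
    using that M glue[of "(j, p)" "(k, q)"] by (auto simp: comp_map_def)
  have \<Phi>_eq: "\<Phi> s j p = \<alpha> j i p * s i (comp_map R j p)"
    if "s \<in> sections (glue J R) L" "j \<in> J" "comp_map R j p \<in> cover L i" for s i j p
  proof -
    let ?c = "chart (comp_map R j p)"
    have "s i (comp_map R j p) = transition L i ?c (comp_map R j p) * s ?c (comp_map R j p)"
      using that chart unfolding sections_def by blast
    then show ?thesis
      using tr[OF that(2,3) chart[OF that(2)]] that(2) by (simp add: \<Phi>_def mult.assoc flip: tr)
  qed
  have "Vector_Spaces.linear scale_sec scale_sec \<Phi>"
    unfolding Vector_Spaces.linear_iff
    by (auto simp: vector_space_scale_sec \<Phi>_def scale_sec_def fun_eq_iff algebra_simps)
  moreover have "inj_on \<Phi> (sections (glue J R) L)"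
  proof (intro inj_onI ext)
    fix s s' i x
    assume s: "s \<in> sections (glue J R) L" "s' \<in> sections (glue J R) L" and eq: "\<Phi> s = \<Phi> s'"
    show "s i x = s' i x"
    proof (cases "x \<in> cover L i")
      case True
      then obtain j p where x: "j \<in> J" "x = comp_map R j p"
        using sub_points by blast
      then show ?thesis
        using \<Phi>_eq[OF s(1) x(1), of p i] \<Phi>_eq[OF s(2) x(1), of p i] True eq nz[OF x(1), of p i] by simp
    next
      case False
      then show ?thesis
        using s by (simp add: sections_def)
    qed
  qed
  moreover have "\<Phi> ` sections (glue J R) L = K"
  proof (intro equalityI subsetI)
    fix F assume "F \<in> \<Phi> ` sections (glue J R) L"
    then obtain s where s: "s \<in> sections (glue J R) L" and F: "F = \<Phi> s" by blast
    have "F j \<in> forms (n j)" if j: "j \<in> J" for j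
    proof -
      have "\<forall>i. regular P1 (comp_map R j -` cover L i) (\<lambda>p. s i (comp_map R j p))"
        using s j unfolding sections_def regular_glue_iff by blast
      then show ?thesis
        using regular_components_iff_form[OF L j \<alpha>[OF j]] \<Phi>_eq[OF s j] unfolding F by blast
    qed
    then have "F \<in> families J n"
      by (auto simp: families_def F \<Phi>_def)
    moreover have "\<kappa> m * case_prod F (fst m) - \<mu> m * case_prod F (snd m) = 0" if m: "m \<in> M" for m
    proof -
      obtain j p k q where m': "m = ((j, p), (k, q))"
        by (metis surj_pair)
      let ?i = "chart (comp_map R j p)"
      note e = same[OF m[unfolded m']]
      have "comp_map R j p \<in> cover L ?i" "comp_map R k q \<in> cover L ?i"
        using chart[OF e(2), of p] chart[OF e(3), of q] e(1) by simp_all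
      then show ?thesis
        using \<Phi>_eq[OF s e(2), of p ?i] \<Phi>_eq[OF s e(3), of q ?i] e(1)
        by (simp add: m' \<kappa>_def \<mu>_def F)
    qed
    ultimately show "F \<in> K"
      by (simp add: K_def)
  next
    fix F assume F: "F \<in> K"
    \<comment> \<open>The condition in \<open>K\<close> refers to the chosen chart. Both
      coefficients change by the same transition value, so it holds in every chart.\<close>
    have compat1: "F j p * \<alpha> k i q = F k q * \<alpha> j i p"
      if m: "((j, p), (k, q)) \<in> M" and i: "comp_map R j p \<in> cover L i" for j k p q i
    proof -
      let ?c = "chart (comp_map R j p)"
      note e = same[OF m]
      have "\<alpha> k ?c q * F j p = \<alpha> j ?c p * F k q"
        using F m unfolding K_def \<kappa>_def \<mu>_def by fastforce
      moreover have "\<alpha> k i q = \<alpha> k ?c q * transition L ?c i (comp_map R j p)"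
        using tr[OF e(3), of q ?c i] chart[OF e(3), of q] i e(1) by simp
      moreover have "\<alpha> j i p = \<alpha> j ?c p * transition L ?c i (comp_map R j p)"
        using tr[OF e(2), of p ?c i] chart[OF e(2)] i by simp
      ultimately show ?thesis
        by (simp add: mult_ac)
    qed
    have compat: "F j p * \<alpha> k i q = F k q * \<alpha> j i p"
      if "j \<in> J" "k \<in> J" "comp_map R j p = comp_map R k q" "comp_map R j p \<in> cover L i" for j k p q i
    proof -
      have "glue_class R (j, p) = glue_class R (k, q)"
        using that(3) by (simp only: comp_map_def)
      moreover have "(j, p) \<in> J \<times> UNIV" "(k, q) \<in> J \<times> UNIV"
        using that(1,2) by simp_all
      ultimately have "(j, p) = (k, q) \<or> ((j, p), (k, q)) \<in> M \<or> ((k, q), (j, p)) \<in> M"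
        using glue by simp
      moreover have "comp_map R k q \<in> cover L i"
        using that(3,4) by simp
      ultimately show ?thesis
        using compat1[of j p k q i] compat1[of k q j p i] that(4) by auto
    qed
    \<comment> \<open>Any point lying over \<open>x\<close> may serve to define the section there;
      \<open>compat\<close> makes the value independent of the choice.\<close>
    define lift where "lift x = (SOME u. fst u \<in> J \<and> comp_map R (fst u) (snd u) = x)" for x
    define s where "s i x = (if x \<in> cover L i
        then F (fst (lift x)) (snd (lift x)) / \<alpha> (fst (lift x)) i (snd (lift x)) else 0)" for i x
    have s_eq: "F j p = \<alpha> j i p * s i (comp_map R j p)"
      if j: "j \<in> J" and i: "comp_map R j p \<in> cover L i" for i j p
    proof -
      let ?u = "lift (comp_map R j p)"
      have u: "fst ?u \<in> J \<and> comp_map R (fst ?u) (snd ?u) = comp_map R j p"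
        unfolding lift_def by (rule someI[of _ "(j, p)"]) (simp add: j)
      then have "F j p * \<alpha> (fst ?u) i (snd ?u) = F (fst ?u) (snd ?u) * \<alpha> j i p"
        using compat[OF j, of "fst ?u" p "snd ?u" i] i by simp
      moreover have "\<alpha> (fst ?u) i (snd ?u) \<noteq> 0"
        using nz[of "fst ?u" "snd ?u" i] u i by simp
      ultimately show ?thesis
        using i by (simp add: s_def field_simps)
    qed
    have "s \<in> sections (glue J R) L"
      unfolding sections_def
    proof (intro CollectI conjI allI ballI impI)
      have "\<forall>i. regular P1 (comp_map R j -` cover L i) (\<lambda>p. s i (comp_map R j p))" if j: "j \<in> J" for j
        using regular_components_iff_form[OF L j \<alpha>[OF j] s_eq[OF j]] F j
        by (auto simp: K_def families_def)
      then show "regular (glue J R) (cover L i) (s i)" for i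
        by (simp add: regular_glue_iff)
      show "s i x = 0" if "x \<notin> cover L i" for i x
        using that by (simp add: s_def)
      fix i i' x assume x: "x \<in> cover L i \<inter> cover L i'"
      then obtain j p where j: "j \<in> J" "x = comp_map R j p"
        using sub_points by blast
      have "\<alpha> j i p * s i x = \<alpha> j i p * (transition L i i' x * s i' x)"
        using s_eq[OF j(1), of p i] s_eq[OF j(1), of p i'] tr[OF j(1), of p i i'] x j(2)
        by (simp add: mult.assoc flip: mult.assoc)
      then show "s i x = transition L i i' x * s i' x"
        using nz[OF j(1), of p i] x j(2) by simp
    qed
    moreover have "\<Phi> s = F"
    proof (intro ext)
      fix j p
      show "\<Phi> s j p = F j p"
      proof (cases "j \<in> J")
        case True
        then show ?thesis
          using s_eq[OF True chart[OF True]] by (simp add: \<Phi>_def)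
      next
        case False
        then show ?thesis
          using F by (simp add: \<Phi>_def K_def families_def)
      qed
    qed
    ultimately show "F \<in> \<Phi> ` sections (glue J R) L"
      by blast
  qed
  ultimately have dim: "fs.has_dim (sections (glue J R) L) d" if "fs.has_dim K d" for d
    using that has_dim_linear_inj subspace_sections[OF L] by metis
  show ?thesis
  proof (rule that[of \<kappa> \<mu>])
    fix m assume m: "m \<in> M"
    obtain j p k q where m': "m = ((j, p), (k, q))"
      by (metis surj_pair)
    note e = same[OF m[unfolded m']]
    have "comp_map R k q \<in> cover L (chart (comp_map R j p))"
      using chart[OF e(2), of p] e(1) by simp
    then show "\<kappa> m \<noteq> 0" "\<mu> m \<noteq> 0"
      using nz[OF e(2) chart[OF e(2)], of p] nz[OF e(3)] by (auto simp only: m' \<kappa>_def \<mu>_def prod.case)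
  qed (use dim K_def in blast)
qed

lemma has_dim_sections_imp:
  assumes "fs.has_dim (sections X L) d"
  shows "finite_h0 X L \<and> h0 X L = d"
  using assms fs.has_dim_dim[OF assms] unfolding finite_h0_def h0_def fs.has_dim_def by blast

text \<open>The functionals are evaluations at \<open>n j\<close> affine points of each component:
  separating forms give the dual family, and too many roots make the common kernel zero. For
  \<open>n j = 0\<close> there are no points and no nonzero forms.\<close>

lemma has_dim_families:
  fixes J :: "'j set"
  assumes J: "finite J"
  shows "fs.has_dim (families J n :: ('j \<Rightarrow> 'k::alg_closed_field proj1 \<Rightarrow> 'k) set) (\<Sum>j\<in>J. n j)"
proof -
  let ?U = "families J n :: ('j \<Rightarrow> 'k proj1 \<Rightarrow> 'k) set"
  have "\<exists>T :: 'k set. finite T \<and> card T = m" for m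
    using infinite_arbitrarily_large[OF infinite_UNIV_alg_closed] by blast
  then obtain T :: "nat \<Rightarrow> 'k set" where T: "\<And>m. finite (T m)" "\<And>m. card (T m) = m"
    by metis
  define R where "R = Sigma J (\<lambda>j. T (n j))"
  define \<phi> where "\<phi> r F = F (fst r) (affine True (snd r))"
    for r :: "'j \<times> 'k" and F :: "'j \<Rightarrow> 'k proj1 \<Rightarrow> 'k"
  have "fs.has_dim ?U (0 + card R)"
  proof (rule fs.has_dim_from_kernel[where \<phi> = \<phi>])
    show "finite R"
      unfolding R_def using J T(1) by blast
    show "fs.functional_on ?U (\<phi> r)" for r
      by (simp add: fs.functional_on_def \<phi>_def scale_sec_def)
    show "\<exists>w\<in>?U. \<phi> r w \<noteq> 0 \<and> (\<forall>s\<in>R. s \<noteq> r \<longrightarrow> \<phi> s w = 0)" if r: "r \<in> R" for r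
    proof -
      obtain j t where jt: "r = (j, t)" "j \<in> J" "t \<in> T (n j)"
        using r unfolding R_def by blast
      let ?Z = "affine True ` (T (n j) - {t})"
      have "card ?Z = n j - 1"
        using T jt(3) by (simp add: card_image inj_on_subset[OF inj_affine])
      moreover have "n j > 0"
        using jt(3) T[of "n j"] by (metis card_gt_0_iff empty_iff)
      moreover have "affine True t \<notin> ?Z"
        by (auto dest: injD[OF inj_affine])
      ultimately obtain f where f: "f \<in> forms (n j)" "f (affine True t) \<noteq> 0" "\<forall>z\<in>?Z. f z = 0"
        using separating_forms[of ?Z "affine True t" "n j"] T(1) by auto
      have "(\<lambda>i. if i = j then f else (\<lambda>_. 0)) \<in> ?U"
        using f(1) jt(2) by (auto simp: families_def forms_zero)
      then show ?thesis
        using f(2,3) by (intro bexI[of _ "\<lambda>i. if i = j then f else (\<lambda>_. 0)"]) (auto simp: \<phi>_def jt(1) R_def)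
    qed
    have "F = 0" if F: "F \<in> ?U" "\<forall>r\<in>R. \<phi> r F = 0" for F
    proof
      fix j
      show "F j = 0 j"
      proof (cases "j \<in> J")
        case True
        then have "F j (affine True t) = 0" if "t \<in> T (n j)" for t
          using F(2) that by (auto simp: R_def \<phi>_def)
        then have "F j = (\<lambda>_. 0)"
          using forms_eq_zero[of "F j" "n j" "T (n j)"] F(1) T True by (simp add: families_def)
        then show ?thesis
          by (simp add: zero_fun_def)
      next
        case False
        then show ?thesis
          using F(1) by (simp add: families_def zero_fun_def)
      qed
    qed
    then have "{F \<in> ?U. \<forall>r\<in>R. \<phi> r F = 0} = {0}"
      using fs.subspace_0[OF subspace_families, of J n] by (auto simp: \<phi>_def)
    then show "fs.has_dim {F \<in> ?U. \<forall>r\<in>R. \<phi> r F = 0} 0"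
      using fs.has_dim_zero by metis
  qed (rule subspace_families)
  moreover have "card R = (\<Sum>j\<in>J. n j)"
    unfolding R_def using J T by (simp add: card_SigmaI)
  ultimately show ?thesis by simp
qed

text \<open>By disjointness a point lies in at most one member of \<open>R\<close>, so a class with
  more than one point is exactly one identified pair. The order in \<open>M\<close> is arbitrary,
  hence both orders on the right.\<close>

lemma glue_class_eq_iff:
  assumes R: "R = (\<lambda>(u, v). {u, v}) ` M"
    and disj: "\<And>r r' u. r \<in> R \<Longrightarrow> r' \<in> R \<Longrightarrow> u \<in> r \<Longrightarrow> u \<in> r' \<Longrightarrow> r = r'"
  shows "glue_class R u = glue_class R v \<longleftrightarrow> u = v \<or> (u, v) \<in> M \<or> (v, u) \<in> M"
proof -
  have ends: "glue_class R a = {a, b} \<and> glue_class R b = {a, b}" if "(a, b) \<in> M" for a b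
  proof -
    have ab: "{a, b} \<in> R"
      using that R by force
    then have "r = {a, b}" if "r \<in> R" "a \<in> r \<or> b \<in> r" for r
      using disj[OF that(1) ab] that(2) by blast
    then show ?thesis
      using ab unfolding glue_class_def by blast
  qed
  have "(u, v) \<in> M \<or> (v, u) \<in> M" if eq: "glue_class R u = glue_class R v" and "u \<noteq> v"
  proof -
    have "v \<in> glue_class R u"
      using eq by (simp add: glue_class_def)
    then obtain r where "r \<in> R" "u \<in> r" "v \<in> r"
      using \<open>u \<noteq> v\<close> unfolding glue_class_def by blast
    then show ?thesis
      using R \<open>u \<noteq> v\<close> by auto
  qed
  then show ?thesis
    using ends by metis
qed

section \<open>Blow-ups of binary curves\<close>

definition node_pairs ::
  "'k::field node set \<Rightarrow> (('k node component \<times> 'k proj1) \<times> ('k node component \<times> 'k proj1)) set" where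
  "node_pairs N = (\<lambda>(p, q). ((C1, p), (C2, q))) ` N"

text \<open>The exceptional branch always comes second, so its coefficient in the condition is \<mu>
  at both ends.\<close>

definition exceptional_pairs ::
  "'k::field node set \<Rightarrow> (('k node component \<times> 'k proj1) \<times> ('k node component \<times> 'k proj1)) set" where
  "exceptional_pairs S = (\<lambda>(p, q). ((C1, p), (E (p, q), pt_zero))) ` S
     \<union> (\<lambda>(p, q). ((C2, q), (E (p, q), pt_infty))) ` S"

lemma blowup_ident_pairs:
  "blowup_ident N S = (\<lambda>(u, v). {u, v}) ` (node_pairs (N - S) \<union> exceptional_pairs S)"
proof -
  have "(\<lambda>(u, v). {u, v}) ` node_pairs (N - S) = binary_ident (N - S)"
    unfolding node_pairs_def binary_ident_def image_image by (intro image_cong refl) auto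
  moreover have "(\<lambda>(u, v). {u, v}) ` exceptional_pairs S =
    (\<Union>(p, q)\<in>S. {{(C1, p), (E (p, q), pt_zero)}, {(C2, q), (E (p, q), pt_infty)}})"
    unfolding exceptional_pairs_def image_Un image_image case_prod_unfold by auto
  ultimately show ?thesis
    unfolding blowup_ident_def image_Un by simp
qed

text \<open>Injectivity of both projections puts at most one node on each point of C1 and of C2, and
  an exceptional component is attached at two different points.\<close>

lemma blowup_ident_disjoint:
  assumes N: "binary_nodes N" and S: "S \<subseteq> N"
    and r: "r \<in> blowup_ident N S" "r' \<in> blowup_ident N S" "u \<in> r" "u \<in> r'"
  shows "r = r'"
proof -
  have q: "q = q'" if "(p, q) \<in> N" "(p, q') \<in> N" for p q q'
    using N that unfolding binary_nodes_def inj_on_def by fastforce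
  have p: "p = p'" if "(p, q) \<in> N" "(p', q) \<in> N" for p p' q
    using N that unfolding binary_nodes_def inj_on_def by fastforce
  have "(\<exists>p q. (p, q) \<in> N - S \<and> r = {(C1, p), (C2, q)}) \<or>
      (\<exists>p q. (p, q) \<in> S \<and> (r = {(C1, p), (E (p, q), pt_zero)} \<or> r = {(C2, q), (E (p, q), pt_infty)}))"
    if "r \<in> blowup_ident N S" for r
    using that unfolding blowup_ident_def binary_ident_def by auto
  from this[OF r(1)] this[OF r(2)] show ?thesis
    using r(3,4) S pt_zero_neq_pt_infty by (elim disjE exE conjE) (auto dest: p q)
qed

lemma blowup_glue_class_eq_iff:
  assumes "binary_nodes N" "S \<subseteq> N"
  shows "glue_class (blowup_ident N S) u = glue_class (blowup_ident N S) v \<longleftrightarrow>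
    u = v \<or> (u, v) \<in> node_pairs (N - S) \<union> exceptional_pairs S
      \<or> (v, u) \<in> node_pairs (N - S) \<union> exceptional_pairs S"
  by (rule glue_class_eq_iff[OF blowup_ident_pairs]) (use blowup_ident_disjoint[OF assms] in blast)

lemma card_node_pairs: "card (node_pairs N) = card N"
  unfolding node_pairs_def by (intro card_image) (auto simp: inj_on_def)

lemma card_exceptional_pairs:
  fixes S :: "'k::field node set"
  assumes "finite S"
  shows "card (exceptional_pairs S) = 2 * card S"
proof -
  have "inj_on (\<lambda>(p, q). ((C1 :: 'k node component, p), (E (p, q), pt_zero :: 'k proj1))) S"
    "inj_on (\<lambda>(p, q). ((C2 :: 'k node component, q), (E (p, q), pt_infty :: 'k proj1))) S"
    by (auto simp: inj_on_def)
  then show ?thesis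
    unfolding exceptional_pairs_def using assms
    by (subst card_Un_disjoint) (auto simp: card_image)
qed

text \<open>\<open>n1\<close> and \<open>n2\<close> are degrees plus one. By \<open>large\<close>,
  one of C1 and C2 carries forms that can vanish at all remaining nodes but one.\<close>

lemma has_dim_sections_blowup:
  fixes L :: "('i, 'k::alg_closed_field) curve_lbundle"
  assumes N: "binary_nodes N" and S: "S \<subseteq> N" and L: "line_bundle (blowup N S) L"
    and degE: "\<forall>\<nu>\<in>S. has_degree (blowup_ident N S) L (E \<nu>) 1"
    and deg1: "has_degree (blowup_ident N S) L C1 (int n1 - 1)"
    and deg2: "has_degree (blowup_ident N S) L C2 (int n2 - 1)"
    and large: "card (N - S) \<le> max n1 n2"
  shows "fs.has_dim (sections (blowup N S) L) (n1 + n2 - card (N - S))"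
proof -
  let ?J = "{C1, C2} \<union> E ` S" and ?Mb = "node_pairs (N - S)" and ?Me = "exceptional_pairs S"
  have finN: "finite N" and finS: "finite S"
    using N S finite_subset unfolding binary_nodes_def by auto
  have inj1: "q = q'" if "(p, q) \<in> N" "(p, q') \<in> N" for p q q'
    using N that unfolding binary_nodes_def inj_on_def by fastforce
  have inj2: "p = p'" if "(p, q) \<in> N" "(p', q) \<in> N" for p p' q
    using N that unfolding binary_nodes_def inj_on_def by fastforce
  define n :: "'k node component \<Rightarrow> nat" where
    "n j = (case j of C1 \<Rightarrow> n1 | C2 \<Rightarrow> n2 | E _ \<Rightarrow> 2)" for j
  have deg: "has_degree (blowup_ident N S) L j (int (n j) - 1)" if "j \<in> ?J" for j
    using that degE deg1 deg2 by (auto simp: n_def)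
  have M: "?Mb \<union> ?Me \<subseteq> (?J \<times> UNIV) \<times> (?J \<times> UNIV)"
    unfolding node_pairs_def exceptional_pairs_def by auto
  obtain \<kappa> \<mu> :: "('k node component \<times> 'k proj1) \<times> ('k node component \<times> 'k proj1) \<Rightarrow> 'k"
    where \<kappa>: "\<And>m. m \<in> ?Mb \<union> ?Me \<Longrightarrow> \<kappa> m \<noteq> 0" and \<mu>: "\<And>m. m \<in> ?Mb \<union> ?Me \<Longrightarrow> \<mu> m \<noteq> 0"
      and dim: "\<And>d. fs.has_dim {F \<in> families ?J n. \<forall>m\<in>?Mb \<union> ?Me.
        \<kappa> m * case_prod F (fst m) - \<mu> m * case_prod F (snd m) = 0} d \<Longrightarrow>
      fs.has_dim (sections (glue ?J (blowup_ident N S)) L) d"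
    using has_dim_sections_glue[OF L[unfolded blowup_def] deg M blowup_glue_class_eq_iff[OF N S]]
    by blast
  define \<phi> where "\<phi> m F = \<kappa> m * case_prod F (fst m) - \<mu> m * case_prod F (snd m)"
    for m and F :: "'k node component \<Rightarrow> 'k proj1 \<Rightarrow> 'k"
  let ?U = "families ?J n :: ('k node component \<Rightarrow> 'k proj1 \<Rightarrow> 'k) set"
  have functional: "fs.functional_on U (\<phi> m)" for U m
    by (simp add: fs.functional_on_def \<phi>_def scale_sec_def algebra_simps split: prod.splits)
  define single :: "'k node component \<Rightarrow> ('k proj1 \<Rightarrow> 'k) \<Rightarrow> 'k node component \<Rightarrow> 'k proj1 \<Rightarrow> 'k"
    where "single j f i = (if i = j then f else (\<lambda>_. 0))" for j f i
  have single: "single j f \<in> ?U" if "j \<in> ?J" "f \<in> forms (n j)" for j f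
    using that by (auto simp: families_def single_def forms_zero)
  have "(\<Sum>j\<in>?J. n j) = (\<Sum>j\<in>{C1, C2}. n j) + (\<Sum>j\<in>E ` S. n j)"
    using finS by (intro sum.union_disjoint) auto
  also have "(\<Sum>j\<in>E ` S. n j) = 2 * card S"
    by (subst sum.reindex) (auto simp: n_def inj_on_def)
  finally have "(\<Sum>j\<in>?J. n j) = n1 + n2 + 2 * card S"
    by (simp add: n_def)
  then have "fs.has_dim ?U (n1 + n2 + 2 * card S)"
    using has_dim_families[of ?J n] finS by simp
  \<comment> \<open>The subtraction is exact, since \<open>large\<close> gives
    \<open>card (N - S) \<le> n1 + n2\<close>. The summand \<open>2 * card S\<close> is kept for the
    second round of conditions.\<close>
  also have "n1 + n2 + 2 * card S = (n1 + n2 - card (N - S) + 2 * card S) + card ?Mb"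
    using large by (simp add: card_node_pairs)
  finally have dimU: "fs.has_dim ?U \<dots>" .
  let ?K = "{F \<in> ?U. \<forall>m\<in>?Mb. \<phi> m F = 0}"
  have dual_b: "\<exists>w\<in>?U. \<phi> m w \<noteq> 0 \<and> (\<forall>m'\<in>?Mb. m' \<noteq> m \<longrightarrow> \<phi> m' w = 0)" if m: "m \<in> ?Mb" for m
  proof -
    obtain p q where pq: "(p, q) \<in> N - S" "m = ((C1, p), (C2, q))"
      using m unfolding node_pairs_def by auto
    let ?A = "N - S - {(p, q)}"
    \<comment> \<open>One node fewer than in \<open>N - S\<close>: the larger of \<open>n1\<close>
      and \<open>n2\<close> leaves room for a form vanishing at the other nodes. Extended by zero to
      the other components, it is dual to \<open>m\<close>.\<close>
    have card: "card ?A < max n1 n2"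
      using large pq(1) finN by (metis card_Diff1_less finite_Diff order_less_le_trans)
    show ?thesis
    proof (cases "card ?A < n1")
      case True
      have "card (fst ` ?A) < n1"
        using True card_image_le[of ?A fst] finN by simp
      moreover have "p \<notin> fst ` ?A"
        using inj1 pq(1) by force
      ultimately obtain f where f: "f \<in> forms n1" "f p \<noteq> 0" "\<forall>z\<in>fst ` ?A. f z = 0"
        using separating_forms[of "fst ` ?A" p n1] finN by auto
      have "\<phi> m (single C1 f) \<noteq> 0"
        using f(2) \<kappa>[of m] m pq(2) by (simp add: \<phi>_def single_def)
      moreover have "\<phi> m' (single C1 f) = 0" if "m' \<in> ?Mb" "m' \<noteq> m" for m'
        using that f(3) pq(2) by (force simp: \<phi>_def single_def node_pairs_def)
      ultimately show ?thesis
        using single[of C1 f] f(1) by (intro bexI[of _ "single C1 f"]) (auto simp: n_def)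
    next
      case False
      then have "card ?A < n2"
        using card by simp
      then have "card (snd ` ?A) < n2"
        using card_image_le[of ?A snd] finN by simp
      moreover have "q \<notin> snd ` ?A"
        using inj2 pq(1) by force
      ultimately obtain f where f: "f \<in> forms n2" "f q \<noteq> 0" "\<forall>z\<in>snd ` ?A. f z = 0"
        using separating_forms[of "snd ` ?A" q n2] finN by auto
      have "\<phi> m (single C2 f) \<noteq> 0"
        using f(2) \<mu>[of m] m pq(2) by (simp add: \<phi>_def single_def)
      moreover have "\<phi> m' (single C2 f) = 0" if "m' \<in> ?Mb" "m' \<noteq> m" for m'
        using that f(3) pq(2) by (force simp: \<phi>_def single_def node_pairs_def)
      ultimately show ?thesis
        using single[of C2 f] f(1) by (intro bexI[of _ "single C2 f"]) (auto simp: n_def)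
    qed
  qed
  have dimK: "fs.has_dim ?K (n1 + n2 - card (N - S) + 2 * card S)"
    by (rule fs.has_dim_kernel[where \<phi> = \<phi>])
      (use finN functional dual_b dimU subspace_families in \<open>auto simp: node_pairs_def\<close>)
  have subK: "fs.subspace ?K"
  proof -
    have "fs.subspace (?U \<inter> (\<Inter>m\<in>?Mb. {F \<in> ?U. \<phi> m F = 0}))"
      using functional
      by (intro fs.subspace_inter fs.subspace_Int fs.subspace_functional_kernel subspace_families)
    also have "?U \<inter> (\<Inter>m\<in>?Mb. {F \<in> ?U. \<phi> m F = 0}) = ?K"
      by auto
    finally show ?thesis .
  qed
  have dual_e: "\<exists>w\<in>?K. \<phi> m w \<noteq> 0 \<and> (\<forall>m'\<in>?Me. m' \<noteq> m \<longrightarrow> \<phi> m' w = 0)" if m: "m \<in> ?Me" for m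
  proof -
    have "(\<exists>p q. (p, q) \<in> S \<and> m = ((C1, p), (E (p, q), pt_zero))) \<or>
        (\<exists>p q. (p, q) \<in> S \<and> m = ((C2, q), (E (p, q), pt_infty)))"
      using m unfolding exceptional_pairs_def by auto
    then obtain u p q and e e' :: "'k proj1" where m': "m = (u, (E (p, q), e))" "(p, q) \<in> S"
      and e: "u = (C1, p) \<and> e = pt_zero \<and> e' = pt_infty \<or> u = (C2, q) \<and> e = pt_infty \<and> e' = pt_zero"
      by metis
    have "e \<notin> {e'}"
      using e pt_zero_neq_pt_infty by auto
    obtain f where f: "f \<in> forms 2" "f e \<noteq> 0" "f e' = 0"
      using separating_forms[of "{e'}" e 2] \<open>e \<notin> {e'}\<close> by auto
    \<comment> \<open>Being supported on an exceptional component, \<open>?w\<close> satisfies all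
      conditions at the nodes joining C1 and C2; as \<open>f\<close> vanishes at the opposite end,
      only the condition \<open>m\<close> sees it.\<close>
    let ?w = "single (E (p, q)) f"
    have "?w \<in> ?K"
      using single[of "E (p, q)" f] f(1) m'(2) by (auto simp: n_def \<phi>_def single_def node_pairs_def)
    moreover have "\<phi> m ?w \<noteq> 0"
      using f(2) \<mu>[of m] m m' e by (auto simp: \<phi>_def single_def)
    moreover have "\<phi> m' ?w = 0" if "m' \<in> ?Me" "m' \<noteq> m" for m'
      using that f(3) m' e unfolding exceptional_pairs_def
      by (auto simp: \<phi>_def single_def split: if_splits)
    ultimately show ?thesis by blast
  qed
  have "fs.has_dim {F \<in> ?K. \<forall>m\<in>?Me. \<phi> m F = 0} (n1 + n2 - card (N - S))"
    by (rule fs.has_dim_kernel[where \<phi> = \<phi>])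
      (use finS functional dual_e dimK subK in \<open>auto simp: exceptional_pairs_def card_exceptional_pairs[OF finS, unfolded exceptional_pairs_def]\<close>)
  also have "{F \<in> ?K. \<forall>m\<in>?Me. \<phi> m F = 0} = {F \<in> ?U. \<forall>m\<in>?Mb \<union> ?Me. \<phi> m F = 0}"
    by blast
  finally show ?thesis
    using dim unfolding \<phi>_def blowup_def by blast
qed

text \<open>Balancedness is imposed on the partial normalization, while sections live on the
  blow-up. Each component maps to the blow-up through the partial normalization; over a remaining
  node the union in \<open>restrict_Y\<close> runs over two branches with the same class.\<close>

lemma has_degree_restrict_Y:
  assumes N: "binary_nodes N" and S: "S \<subseteq> N" and j: "j \<in> {C1, C2}"
  shows "has_degree (binary_ident (N - S)) (restrict_Y N S L) j k \<longleftrightarrow> has_degree (blowup_ident N S) L j k"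
proof -
  let ?B = "binary_ident (N - S)" and ?Bl = "blowup_ident N S"
  have point: "(\<Union>b\<in>comp_map ?B j p. glue_class ?Bl b) = comp_map ?Bl j p" for p
  proof -
    have "glue_class ?Bl b = glue_class ?Bl (j, p)" if b: "b \<in> glue_class ?B (j, p)" for b
    proof (cases "b = (j, p)")
      case False
      then obtain r where r: "r \<in> ?B" "(j, p) \<in> r" "b \<in> r"
        using b unfolding glue_class_def by blast
      then have "((j, p), b) \<in> node_pairs (N - S) \<or> (b, (j, p)) \<in> node_pairs (N - S)"
        using False unfolding binary_ident_def node_pairs_def by auto
      then show ?thesis
        using blowup_glue_class_eq_iff[OF N S, of b "(j, p)"] by blast
    qed simp
    moreover have "(j, p) \<in> glue_class ?B (j, p)"
      by (simp add: glue_class_def)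
    ultimately show ?thesis
      unfolding comp_map_def by blast
  qed
  have "comp_map ?B j p \<in> points (binary_curve (N - S))" for p
    unfolding binary_curve_def using j by (rule comp_map_in_points)
  then have "pullback P1 (comp_map ?B j) (restrict_Y N S L) = pullback P1 (comp_map ?Bl j) L"
    unfolding pullback_def restrict_Y_def by (simp add: point)
  then show ?thesis
    unfolding has_degree_def by simp
qed

text \<open>Phrased through degrees on the blow-up, so that \<open>S = {}\<close> covers line
  bundles on the curve itself.\<close>

lemma h0_blowup:
  fixes L :: "('i, 'k::alg_closed_field) curve_lbundle"
  assumes N: "binary_nodes N" and S: "S \<subseteq> N" and L: "line_bundle (blowup N S) L"
    and degE: "\<forall>\<nu>\<in>S. has_degree (blowup_ident N S) L (E \<nu>) 1"
    and deg: "has_degree (blowup_ident N S) L C1 (fst md)" "has_degree (blowup_ident N S) L C2 (snd md)"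
    and bal: "balanced (genus (N - S)) md" and d: "fst md + snd md \<ge> 2 * genus (N - S) - 1"
  shows "finite_h0 (blowup N S) L \<and>
    int (h0 (blowup N S) L) = fst md + snd md - genus (N - S) + 1"
proof -
  define c where "c = int (card (N - S))"
  have g: "genus (N - S) = c - 1" and c: "c \<ge> 0"
    by (simp_all add: genus_def c_def)
  have "2 * fst md \<ge> fst md + snd md - c" "2 * snd md \<ge> fst md + snd md - c"
    using bal unfolding balanced_def Let_def g by auto
  \<comment> \<open>Twice each degree is at least \<open>c - 3 \<ge> -3\<close>, so integrality
    gives -1, the least degree in which the dimension of the space of forms is still the degree plus
    one.\<close>
  then have lower: "fst md \<ge> -1" "snd md \<ge> -1"
    using d c unfolding g by auto
  define n1 n2 where "n1 = nat (fst md + 1)" and "n2 = nat (snd md + 1)"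
  have n: "fst md = int n1 - 1" "snd md = int n2 - 1"
    using lower by (simp_all add: n1_def n2_def)
  \<comment> \<open>The degree bound reads \<open>n1 + n2 \<ge> 2 * c - 1\<close>, and an integer
    that is at least c - 1/2 is at least \<open>c\<close>.\<close>
  have large: "card (N - S) \<le> max n1 n2"
    using d unfolding g n c_def by simp
  have "fs.has_dim (sections (blowup N S) L) (n1 + n2 - card (N - S))"
    using has_dim_sections_blowup[OF N S L degE _ _ large] deg unfolding n by blast
  from has_dim_sections_imp[OF this] show ?thesis
    using large unfolding g n c_def by auto
qed

section \<open>Line bundles on the curve and points of the compactified Picard variety\<close>

lemma blowup_empty: "blowup N {} = binary_curve N" "blowup_ident N {} = binary_ident N"
  by (simp_all add: blowup_def binary_curve_def blowup_ident_def)

lemma genus_Diff: "finite N \<Longrightarrow> S \<subseteq> N \<Longrightarrow> genus (N - S) = genus N - int (card S)"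
  using finite_subset[of S N] card_mono[of N S] by (simp add: genus_def card_Diff_subset of_nat_diff)

theorem proposition11:
  fixes N :: "'k::alg_closed_field node set" and g d :: int
  assumes "binary_nodes N" and "genus N = g" and "d \<ge> 2 * g - 1"
  shows "(\<forall>L :: ('i, 'k) curve_lbundle. balanced_lb N d L \<longrightarrow>
            finite_h0 (binary_curve N) L \<and> int (h0 (binary_curve N) L) = d - g + 1) \<and>
         (g \<ge> 2 \<longrightarrow>
            (\<forall>P \<in> (compactified_Pic N d :: ('k node set \<times> ('i, 'k) curve_lbundle) set set).
               \<forall>(S, L) \<in> P.
                 finite_h0 (blowup N S) L \<and> int (h0 (blowup N S) L) = d - g + 1))"
proof (intro conjI allI impI ballI)
  fix L :: "('i, 'k) curve_lbundle"
  assume "balanced_lb N d L"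
  then obtain md where L: "line_bundle (binary_curve N) L" and md: "has_multidegree N L md"
    "fst md + snd md = d" "balanced (genus N) md"
    unfolding balanced_lb_def by blast
  have "finite_h0 (binary_curve N) L \<and> int (h0 (binary_curve N) L) = d - g + 1"
    using h0_blowup[of N "{}" L md] assms L md by (simp add: blowup_empty has_multidegree_def)
  then show "finite_h0 (binary_curve N) L" "int (h0 (binary_curve N) L) = d - g + 1"
    by blast+
next
  fix P :: "('k node set \<times> ('i, 'k) curve_lbundle) set" and x
  assume g: "2 \<le> g" and P: "P \<in> compactified_Pic N d" and x: "x \<in> P"
  obtain S L where x': "x = (S, L)" by (cases x)
  \<comment> \<open>The relation holds between representatives only, so every member of a class is
    one.\<close>
  have rep: "(S, L) \<in> picbar_sb_reps N d \<or> (S, L) \<in> picbar_l0_reps N d"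
    using P x unfolding compactified_Pic_def picbar_equiv_def quotient_def x' by auto
  then have S: "S \<subseteq> N" and L: "line_bundle (blowup N S) L"
    and degE: "\<forall>\<nu>\<in>S. has_degree (blowup_ident N S) L (E \<nu>) 1"
    unfolding picbar_sb_reps_def picbar_l0_reps_def by auto
  have finN: "finite N"
    using assms(1) by (simp add: binary_nodes_def)
  have gS: "genus (N - S) = g - int (card S)"
    using genus_Diff[OF finN S] assms(2) by simp
  have "\<exists>md. has_multidegree (N - S) (restrict_Y N S L) md \<and>
      fst md + snd md = d - int (card S) \<and> balanced (genus (N - S)) md"
    using rep
  proof
    assume "(S, L) \<in> picbar_sb_reps N d"
    then show ?thesis
      unfolding picbar_sb_reps_def strictly_balanced_lb_def strictly_balanced_def balanced_def
      by (fastforce simp: Let_def)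
  next
    assume "(S, L) \<in> picbar_l0_reps N d"
    then obtain m where m: "S = N" "2 * m = d - genus N - 1"
      "has_multidegree (N - S) (restrict_Y N S L) (m, m)"
      unfolding picbar_l0_reps_def by blast
    \<comment> \<open>With every node blown up the genus is -1, and the bounds force each degree to
      be half of the total \<open>2 * m = d - card N\<close>.\<close>
    then show ?thesis
      by (intro exI[of _ "(m, m)"]) (auto simp: balanced_def genus_def)
  qed
  then obtain md where md: "has_multidegree (N - S) (restrict_Y N S L) md"
    "fst md + snd md = d - int (card S)" "balanced (genus (N - S)) md"
    by blast
  have deg: "has_degree (blowup_ident N S) L C1 (fst md)" "has_degree (blowup_ident N S) L C2 (snd md)"
    using md(1) has_degree_restrict_Y[OF assms(1) S] unfolding has_multidegree_def by auto
  \<comment> \<open>Lowering \<open>d\<close> and \<open>g\<close> by \<open>card S\<close>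
    preserves \<open>d - g + 1\<close> and relaxes the bound \<open>d \<ge> 2 * g - 1\<close> by
    \<open>card S\<close>.\<close>
  have "finite_h0 (blowup N S) L \<and> int (h0 (blowup N S) L) = d - g + 1"
    using h0_blowup[OF assms(1) S L degE deg md(3)] assms(3) by (simp add: md(2) gS)
  then show "case x of (S, L) \<Rightarrow> finite_h0 (blowup N S) L \<and> int (h0 (blowup N S) L) = d - g + 1"
    by (simp add: x')
qed

end
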